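(* For a metrizable space $X$ the following statements are equivalent: (1) $X$ is $\sigma$-compact; (2) $C_p(X)$ is $F_\sigma$-Lusin; (3) $C_k(X)$ is $F_\sigma$-Lusin; (4) $C_{\downarrow\mathsf F}(X)$ is $C_{\delta\sigma}$-Lusin; (5) $C_p(X)$ is Lusin; (6) $C_k(X)$ is Lusin; (7) $C_{\downarrow\mathsf F}(X)$ is Lusin; (8) $C_p(X)$ is Suslin; (9) $C_k(X)$ is Suslin; (10) $C_{\downarrow\mathsf F}(X)$ is Suslin.
   Context: Let $C(X)$ be the set of continuous real-valued functions on $X$. - $C_p(X)$ is $C(X)$ with the topology of pointwise convergence. - $C_k(X)$ is $C(X)$ with the compact-open topology, generated by the subbase of sets $\{f\in C(X):\min f(K)>r\}$ and $\{f\in C(X):\max f(K)<r\}$, where $K\subset X$ is nonempty compact and $r\in\mathbb{R}$. - $C_{\downarrow\mathsf F}(X)$ is $C(X)$ with the Fell hypograph topology, generated by the subbase of sets $\{f\in C(X):\max f(K)<r\}$ and $\{f\in C(X):\sup f(U)>r\}$, where $K\subset X$ is nonempty compact, $U\subset X$ is nonempty open, and $r\in\mathbb{R}$. A subset of a topological space $X$ is constructible if it belongs to the smallest algebra of subsets of $X$ containing all open sets; an $F_\sigma$-set is a countable union of closed sets; a $C_\delta$-set is a countable intersection of constructible sets; a $C_{\delta\sigma}$-set is a countable union of $C_\delta$-sets. A topological space is Polish if it is homeomorphic to a separable complete metric space; Suslin if it is the image of a Polish space under a continuous map; Lusin if it is the image of a Polish space under a continuous bijective map. For a class $\Gamma$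 of Borel sets (here $F_\sigma$ or $C_{\delta\sigma}$), a function $f:X\to Y$ is $\Gamma$-measurable if for every open $U\subset Y$ the preimage $f^{-1}(U)$ is of class $\Gamma$ in $X$. A space $X$ is $\Gamma$-Lusin if it is the image of a Polish space $P$ under a continuous bijective map $f:P\to X$ whose inverse $f^{-1}:X\to P$ is $\Gamma$-measurable. *)

theory Defs
  imports "HOL-Analysis.Analysis"
begin

section \<open>Function spaces\<close>

text \<open>Continuous functions on the carrier \<^term>\<open>topspace X\<close> are represented by their extensional
  representatives (value \<^term>\<open>undefined\<close> outside the carrier), as in \<^const>\<open>product_topology\<close>.\<close>

definition C_fun :: "'a topology \<Rightarrow> ('a \<Rightarrow> real) set" where
  "C_fun X = {f \<in> extensional (topspace X). continuous_map X euclideanreal f}"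

definition C_p :: "'a topology \<Rightarrow> ('a \<Rightarrow> real) topology" where
  "C_p X = subtopology (powertop_real (topspace X)) (C_fun X)"

text \<open>In the two subbases below the set \<^term>\<open>C_fun X\<close> itself is inserted so that the carrier is
  \<^term>\<open>C_fun X\<close> even when \<^term>\<open>X\<close> is empty (the empty intersection of subbasic sets is the whole
  space); for nonempty \<^term>\<open>X\<close> this changes nothing.  For a nonempty compact \<^term>\<open>K\<close>, the real
  infimum and supremum of \<^term>\<open>f ` K\<close> are its minimum and maximum.  The supremum over an
  open set may be infinite and is therefore taken in \<^typ>\<open>ereal\<close>.\<close>

definition C_k :: "'a topology \<Rightarrow> ('a \<Rightarrow> real) topology" where
  "C_k X = topology_generated_by (insert (C_fun X)
     ({{f \<in> C_fun X. Inf (f ` K) > r} | K r. compactin X K \<and> K \<noteq> {}} \<union>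
      {{f \<in> C_fun X. Sup (f ` K) < r} | K r. compactin X K \<and> K \<noteq> {}}))"

definition C_Fell :: "'a topology \<Rightarrow> ('a \<Rightarrow> real) topology" where
  "C_Fell X = topology_generated_by (insert (C_fun X)
     ({{f \<in> C_fun X. Sup (f ` K) < r} | K r. compactin X K \<and> K \<noteq> {}} \<union>
      {{f \<in> C_fun X. (SUP x\<in>U. ereal (f x)) > ereal r} | U r. openin X U \<and> U \<noteq> {}}))"


section \<open>Descriptive classes of sets and functions\<close>

definition sigma_compact_space :: "'a topology \<Rightarrow> bool" where
  "sigma_compact_space X \<longleftrightarrow> (countable union_of compactin X) (topspace X)"

definition constructible_in :: "'a topology \<Rightarrow> 'a set \<Rightarrow> bool" where
  "constructible_in X S \<longleftrightarrow> S \<in> \<Inter>{\<A>. algebra (topspace X) \<A> \<and> Collect (openin X) \<subseteq> \<A>}"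

definition cdelta_in :: "'a topology \<Rightarrow> 'a set \<Rightarrow> bool" where
  "cdelta_in X = (countable intersection_of constructible_in X) relative_to topspace X"

definition cdelta_sigma_in :: "'a topology \<Rightarrow> 'a set \<Rightarrow> bool" where
  "cdelta_sigma_in X = countable union_of cdelta_in X"

text \<open>A class of sets is a predicate such as \<^const>\<open>fsigma_in\<close> or \<^const>\<open>cdelta_sigma_in\<close>,
  here applied to the domain space.\<close>

definition class_measurable ::
  "('a topology \<Rightarrow> 'a set \<Rightarrow> bool) \<Rightarrow> 'a topology \<Rightarrow> 'b topology \<Rightarrow> ('a \<Rightarrow> 'b) \<Rightarrow> bool" where
  "class_measurable \<Gamma> X Y f \<longleftrightarrow> f \<in> topspace X \<rightarrow> topspace Y \<and>
     (\<forall>U. openin Y U \<longrightarrow> \<Gamma> X {x \<in> topspace X. f x \<in> U})"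


section \<open>Polish, Suslin and Lusin spaces\<close>

definition Polish_space :: "'a topology \<Rightarrow> bool" where
  "Polish_space X \<longleftrightarrow> completely_metrizable_space X \<and> separable_space X"

text \<open>One cannot quantify over types inside a formula, so the Polish space \<^term>\<open>P\<close> ranges over the
  topologies whose carrier is any subset of \<^typ>\<open>nat \<Rightarrow> real\<close>.  This is no restriction: every
  Polish space, over any type, is homeomorphic to such a topology; see \<open>Suslin_spaceI\<close>,
  \<open>Lusin_spaceI\<close> and \<open>class_Lusin_spaceI\<close> below.\<close>

definition Suslin_space :: "'a topology \<Rightarrow> bool" where
  "Suslin_space X \<longleftrightarrow> (\<exists>(P :: (nat \<Rightarrow> real) topology) f.
     Polish_space P \<and> continuous_map P X f \<and> f ` topspace P = topspace X)"

definition Lusin_space :: "'a topology \<Rightarrow> bool" where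
  "Lusin_space X \<longleftrightarrow> (\<exists>(P :: (nat \<Rightarrow> real) topology) f.
     Polish_space P \<and> continuous_map P X f \<and> bij_betw f (topspace P) (topspace X))"

definition class_Lusin_space :: "('a topology \<Rightarrow> 'a set \<Rightarrow> bool) \<Rightarrow> 'a topology \<Rightarrow> bool" where
  "class_Lusin_space \<Gamma> X \<longleftrightarrow> (\<exists>(P :: (nat \<Rightarrow> real) topology) f.
     Polish_space P \<and> continuous_map P X f \<and> bij_betw f (topspace P) (topspace X) \<and>
     class_measurable \<Gamma> X P (inv_into (topspace P) f))"

lemma Polish_space_inj:
  assumes "Polish_space P"
  shows "\<exists>j :: 'a \<Rightarrow> nat \<Rightarrow> real. inj_on j (topspace (P :: 'a topology))"
proof -
  obtain M d where "Metric_space M d" and P: "P = Metric_space.mtopology M d"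
    using assms unfolding Polish_space_def completely_metrizable_space_def by blast
  then interpret Metric_space M d by simp
  obtain D where D: "countable D" "D \<subseteq> M" "mtopology closure_of D = M"
    using assms P unfolding Polish_space_def separable_space_def by auto
  define j where "j = (\<lambda>x n. d x (from_nat_into D n))"
  have "inj_on j M"
  proof (intro inj_onI, rule ccontr)
    fix x y assume xy: "x \<in> M" "y \<in> M" "j x = j y" "x \<noteq> y"
    then have pos: "d x y > 0" by simp
    have "x \<in> mtopology closure_of D" using D xy by simp
    then obtain q where q: "q \<in> D" "q \<in> mball x (d x y / 2)"
      using half_gt_zero[OF pos] unfolding metric_closure_of by blast
    then obtain n where "from_nat_into D n = q"
      using D(1) by (metis from_nat_into_surj)
    then have "d x q = d y q" using xy(3) unfolding j_def by metis
    moreover have "d x q < d x y / 2" "q \<in> M" using q by auto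
    moreover have "d x y \<le> d x q + d y q"
      using triangle[of x q y] xy \<open>q \<in> M\<close> commute[of q y] by simp
    ultimately show False by simp
  qed
  then show ?thesis using P by auto
qed

lemma Polish_space_transfer:
  assumes "Polish_space (P :: 'a topology)"
  obtains P' :: "(nat \<Rightarrow> real) topology" and g where "Polish_space P'" "homeomorphic_map P' P g"
proof -
  obtain j :: "'a \<Rightarrow> nat \<Rightarrow> real" where j: "inj_on j (topspace P)"
    using Polish_space_inj[OF assms] by blast
  let ?M = "topspace P"
  define g where "g = inv_into ?M j"
  define P' where "P' = pullback_topology (j ` ?M) g P"
  have gj: "g (j x) = x" if "x \<in> ?M" for x using that j by (simp add: g_def)
  have top: "topspace P' = j ` ?M"
    unfolding P'_def topspace_pullback_topology using gj by auto
  have "homeomorphic_map P' P g"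
  proof (rule bijective_open_imp_homeomorphic_map)
    show "continuous_map P' P g"
      unfolding continuous_map_def top
      using gj by (auto simp: P'_def openin_pullback_topology)
    show "open_map P' P g"
      unfolding open_map_def
    proof (intro allI impI)
      fix S assume "openin P' S"
      then obtain U where U: "openin P U" "S = g -` U \<inter> j ` ?M"
        unfolding P'_def openin_pullback_topology by blast
      have "g ` S = U"
      proof
        show "g ` S \<subseteq> U" using U(2) by blast
        show "U \<subseteq> g ` S"
        proof
          fix x assume "x \<in> U"
          moreover from this have "x \<in> ?M" using openin_subset[OF U(1)] by blast
          ultimately have "j x \<in> S" "g (j x) = x" using U(2) gj by auto
          then show "x \<in> g ` S" by (metis imageI)
        qed
      qed
      with U show "openin P (g ` S)" by simp
    qed
    show "g ` topspace P' = topspace P" unfolding top image_image using gj by simp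
    show "inj_on g (topspace P')" unfolding top g_def by (rule inj_on_inv_into) simp
  qed
  moreover from this have "P' homeomorphic_space P" by (rule homeomorphic_map_imp_homeomorphic_space)
  from homeomorphic_completely_metrizable_space[OF this] homeomorphic_separable_space[OF this]
  have "Polish_space P'"
    using assms unfolding Polish_space_def by simp
  ultimately show thesis using that by blast
qed

lemma Suslin_spaceI:
  assumes "Polish_space (P :: 'b topology)" "continuous_map P X f" "f ` topspace P = topspace X"
  shows "Suslin_space X"
proof -
  obtain P' :: "(nat \<Rightarrow> real) topology" and g
    where P': "Polish_space P'" and g: "homeomorphic_map P' P g"
    using Polish_space_transfer[OF assms(1)] .
  have "continuous_map P' X (f \<circ> g)"
    using g assms(2) continuous_map_compose homeomorphic_imp_continuous_map by blast
  moreover have "(f \<circ> g) ` topspace P' = topspace X"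
    using g assms(3) homeomorphic_imp_surjective_map by (metis image_comp)
  ultimately show ?thesis using P' unfolding Suslin_space_def by blast
qed

lemma Lusin_spaceI:
  assumes "Polish_space (P :: 'b topology)" "continuous_map P X f"
    "bij_betw f (topspace P) (topspace X)"
  shows "Lusin_space X"
proof -
  obtain P' :: "(nat \<Rightarrow> real) topology" and g
    where P': "Polish_space P'" and g: "homeomorphic_map P' P g"
    using Polish_space_transfer[OF assms(1)] .
  have "continuous_map P' X (f \<circ> g)"
    using g assms(2) continuous_map_compose homeomorphic_imp_continuous_map by blast
  moreover have "bij_betw (f \<circ> g) (topspace P') (topspace X)"
  proof (rule bij_betw_trans)
    show "bij_betw g (topspace P') (topspace P)"
      using g by (simp add: bij_betw_def homeomorphic_imp_injective_map homeomorphic_imp_surjective_map)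
  qed (rule assms(3))
  ultimately show ?thesis using P' unfolding Lusin_space_def by blast
qed

lemma class_Lusin_spaceI:
  assumes "Polish_space (P :: 'b topology)" "continuous_map P X f"
    "bij_betw f (topspace P) (topspace X)" "class_measurable \<Gamma> X P (inv_into (topspace P) f)"
  shows "class_Lusin_space \<Gamma> X"
proof -
  obtain P' :: "(nat \<Rightarrow> real) topology" and g
    where P': "Polish_space P'" and g: "homeomorphic_map P' P g"
    using Polish_space_transfer[OF assms(1)] .
  let ?h = "inv_into (topspace P') (f \<circ> g)"
  have gb: "bij_betw g (topspace P') (topspace P)"
    using g by (simp add: bij_betw_def homeomorphic_imp_injective_map homeomorphic_imp_surjective_map)
  have cont: "continuous_map P' X (f \<circ> g)"
    using g assms(2) continuous_map_compose homeomorphic_imp_continuous_map by blast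
  have bij: "bij_betw (f \<circ> g) (topspace P') (topspace X)"
    using gb assms(3) by (rule bij_betw_trans)
  have h: "?h x \<in> topspace P'" "f (g (?h x)) = x" if "x \<in> topspace X" for x
    using bij_betw_inv_into_right[OF bij that] bij_betw_apply[OF bij_betw_inv_into[OF bij] that]
    by simp_all
  have gh: "g (?h x) = inv_into (topspace P) f x" if "x \<in> topspace X" for x
    using bij_betw_inv_into_left[OF assms(3) bij_betw_apply[OF gb h(1)[OF that]]]
    unfolding h(2)[OF that] by simp
  have "class_measurable \<Gamma> X P' ?h"
    unfolding class_measurable_def
  proof (intro conjI allI impI)
    show "?h \<in> topspace X \<rightarrow> topspace P'" using h by blast
    fix U assume U: "openin P' U"
    then have "openin P (g ` U)" using homeomorphic_map_openness[OF g openin_subset[OF U]] by simp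
    then have "\<Gamma> X {x \<in> topspace X. inv_into (topspace P) f x \<in> g ` U}"
      using assms(4) unfolding class_measurable_def by blast
    moreover have "inv_into (topspace P) f x \<in> g ` U \<longleftrightarrow> ?h x \<in> U" if "x \<in> topspace X" for x
      using inj_on_image_mem_iff[OF bij_betw_imp_inj_on[OF gb] h(1)[OF that] openin_subset[OF U]]
      unfolding gh[OF that] .
    then have "{x \<in> topspace X. inv_into (topspace P) f x \<in> g ` U} = {x \<in> topspace X. ?h x \<in> U}"
      by blast
    ultimately show "\<Gamma> X {x \<in> topspace X. ?h x \<in> U}" by simp
  qed
  then show ?thesis using P' cont bij unfolding class_Lusin_space_def by blast
qed

end

theory Submission
  imports Defs
begin

text \<open>The fine implications (class Lusin implies Lusin implies Suslin) are trivial, so two things have to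
be shown: a \<open>\<sigma>\<close>-compact \<open>X\<close> gives the three class Lusin properties, and each of the three Suslin
properties gives \<open>\<sigma>\<close>-compactness.

\<^bold>\<open>From \<open>\<sigma>\<close>-compact to Lusin.\<close>  One Polish topology on the set \<open>C(X)\<close> serves all three function spaces.
Write \<open>X\<close> as a union of compact sets \<open>K n\<close> and let \<open>q\<close> enumerate a set that is dense in each of them.  A
continuous function is uniformly continuous at every \<open>K n\<close>: for all \<open>n\<close> and \<open>m\<close> there is a least
natural number \<open>k\<close> such that \<open>k * d x y < 1\<close>, with \<open>x\<close> in \<open>K n\<close> and \<open>y\<close> arbitrary, forces
\<open>f x\<close> and \<open>f y\<close> to differ by at most \<open>1/(m+1)\<close>.  Record the values of \<open>f\<close> on \<open>q\<close> together with all these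
numbers \<open>k\<close>.  A function on the dense set that has such numbers \<open>k\<close> extends to a continuous
function on \<open>X\<close>, so the records that arise in this way can be described on \<open>q\<close> alone, by one closed and one open condition for each pair of \<open>n\<close>
and \<open>m\<close> (and the closed condition that \<open>k\<close> is a natural number); they form a \<open>G\<^sub>\<delta>\<close> set of sequences of reals.
So the topology that \<open>C(X)\<close> inherits from the recorded data is Polish.  Near a given
function the recorded numbers are locally constant, hence the functions there are
equicontinuous and pointwise closeness on \<open>q\<close> becomes uniform closeness on compact sets: the new
topology refines the compact-open one, and with it the other two.  Its open sets are countable
unions of finite intersections of sets given by one value or one number \<open>k\<close>, and by continuity such
conditions only involve countably many inequalities between values.  Counting quantifiers
shows that they are \<open>F\<^sub>\<sigma>\<close> as soon as evaluations are continuous, and \<open>C\<^sub>\<delta>\<^sub>\<sigma>\<close> as soon as the sets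
\<open>f x < r\<close> are open (\<open>code_topology_open_in_class\<close>).

\<^bold>\<open>From Suslin to \<open>\<sigma>\<close>-compact.\<close>  Here only the openness of the sets \<open>f x < r\<close> is used, which holds in all
three topologies, so they are treated at once.  Let \<open>t\<close> map a Polish space \<open>P\<close> continuously onto
\<open>C(X)\<close>.  A countable base of \<open>P\<close> yields a countable network of \<open>X\<close>, so \<open>X\<close> is separable and may be seen
as a subset \<open>S\<close> of a metrizable compact space \<open>K\<close>.  It is enough that \<open>Y = K - S\<close> is, up to points of \<open>S\<close> outside
its closure, a countable intersection of open sets.  This is a direct version of Christensen's
theorem on cofinal families of compact sets.  Say that \<open>f\<close> controls \<open>L\<close> if \<open>f x * dist x y \<ge> 1\<close>
for all \<open>x\<close> in \<open>S\<close> and \<open>y\<close> in \<open>L\<close>.  Each compact \<open>L\<close> in \<open>Y\<close> is controlled by a continuous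
function on \<open>S\<close>, the reciprocal of the distance to \<open>L\<close>.  Splitting \<open>P\<close> into a tree of smaller and smaller
pieces \<open>Q s\<close>, let \<open>U s\<close> consist of the points near which every compact subset of \<open>Y\<close> is
controlled by a function coming from \<open>Q s\<close>.  A diagonal argument with a sequence of compact sets shrinking to a
point shows that the \<open>U s\<close> form a sieve on \<open>Y\<close>.  A point of \<open>S\<close> in the closure of \<open>Y\<close> cannot lie in all
\<open>U s\<close> along a branch: otherwise a convergent sequence in \<open>P\<close> would have values at that point
tending to infinity, against \<open>f x < r\<close> being open (\<open>sieve_of_dominating_functions\<close>).  Point-finite
refinement and Koenig's lemma turn the sieve into the countable intersection wanted
(\<open>sieve_Inter_open\<close>).\<close>

section \<open>Sieves in metric spaces\<close>

lemma closed_ball_subset: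
  fixes W :: "'b::metric_space set"
  shows "closed {x. ball x \<rho> \<subseteq> W}"
proof -
  have "{x. ball x \<rho> \<subseteq> W} = - (\<Union>z\<in>-W. ball z \<rho>)"
    by (auto simp: dist_commute)
  then show ?thesis by (metis open_UN open_ball closed_Compl)
qed

text \<open>A point of the \<open>k\<close>-th set is kept only if it is closer than \<open>1/(k+1)\<close> to the complement of each earlier
set.  A point of \<open>W j\<close> has positive distance from that complement and is therefore dropped for all large \<open>k\<close>,
while the first set that contains a point always keeps it.\<close>

lemma point_finite_refinement:
  fixes W :: "nat \<Rightarrow> 'b::metric_space set"
  assumes W: "\<And>k. open (W k)"
  obtains V where "\<And>k. open (V k)" "\<And>k. V k \<subseteq> W k" "(\<Union>k. V k) = (\<Union>k. W k)"
    "\<And>x. finite {k. x \<in> V k}"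
proof
  define V where "V k = W k \<inter> (\<Inter>j<k. - {x. ball x (1 / real (Suc k)) \<subseteq> W j})" for k
  show "open (V k)" for k
    unfolding V_def using W closed_ball_subset by (intro open_Int open_INT) auto
  show sub: "V k \<subseteq> W k" for k by (auto simp: V_def)
  show "(\<Union>k. V k) = (\<Union>k. W k)"
  proof (intro equalityI subsetI)
    fix x assume "x \<in> (\<Union>k. W k)"
    then have ex: "\<exists>k. x \<in> W k" by blast
    have "x \<in> V (LEAST k. x \<in> W k)"
    proof -
      have "\<not> ball x (1 / real (Suc k)) \<subseteq> W j" if "j < (LEAST k. x \<in> W k)" for j k
      proof -
        have "x \<in> ball x (1 / real (Suc k))" by simp
        then show ?thesis using not_less_Least[OF that] by blast
      qed
      then show ?thesis unfolding V_def using LeastI_ex[OF ex] by blast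
    qed
    then show "x \<in> (\<Union>k. V k)" by blast
  qed (use sub in blast)
  show "finite {k. x \<in> V k}" for x
  proof (cases "\<exists>j. x \<in> W j")
    case True
    then obtain j e where e: "e > 0" "ball x e \<subseteq> W j" using W open_contains_ball by blast
    obtain N where N: "inverse (real (Suc N)) < e" using e reals_Archimedean by blast
    have "k \<le> max j N" if "x \<in> V k" for k
    proof (rule ccontr)
      assume "\<not> k \<le> max j N"
      then have k: "j < k" "N < k" by auto
      then have "1 / real (Suc k) \<le> inverse (real (Suc N))" by (simp add: field_simps)
      with N e have "ball x (1 / real (Suc k)) \<subseteq> W j" by fastforce
      with that k show False by (auto simp: V_def)
    qed
    then show ?thesis by (meson finite_nat_set_iff_bounded_le mem_Collect_eq)
  next
    case False
    then have "{k. x \<in> V k} = {}" using sub by blast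
    then show ?thesis by simp
  qed
qed

text \<open>Finite sequences are stored in reverse, so that extending a node of the tree is a \<open>#\<close>.\<close>

definition branch :: "(nat \<Rightarrow> 'k list) \<Rightarrow> bool" where
  "branch \<sigma> \<longleftrightarrow> \<sigma> 0 = [] \<and> (\<forall>n. \<exists>k. \<sigma> (Suc n) = k # \<sigma> n)"

lemma branch_length: "branch \<sigma> \<Longrightarrow> length (\<sigma> n) = n"
  by (induction n) (auto simp: branch_def, metis length_Cons)

text \<open>The sets \<open>G n\<close> are the unions of the levels of the sieve after it has been made point-finite.  A
point in all of them has finitely many children below each node of its tree of nodes, and
this tree is infinite, so by Koenig's lemma it has an infinite branch.  Without point-finiteness the nodes
found on different levels need not fit together.\<close>

lemma sieve_Inter_open:
  fixes U :: "nat list \<Rightarrow> 'b::metric_space set"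
  assumes U: "\<And>s. open (U s)" and Y: "Y \<subseteq> U []" and step: "\<And>s. Y \<inter> U s \<subseteq> (\<Union>k. U (k # s))"
  shows "\<exists>G :: nat \<Rightarrow> 'b set. (\<forall>n. open (G n)) \<and> (\<forall>n. Y \<subseteq> G n) \<and>
    (\<forall>x. (\<forall>n. x \<in> G n) \<longrightarrow> (\<exists>\<sigma>. branch \<sigma> \<and> (\<forall>n. x \<in> U (\<sigma> n))))"
proof -
  define ref where "ref W V \<longleftrightarrow> (\<forall>k. open (V k)) \<and> (\<forall>k. V k \<subseteq> W k) \<and>
    (\<Union>k. V k) = (\<Union>k. W k) \<and> (\<forall>x. finite {k. x \<in> V k})" for W V :: "nat \<Rightarrow> 'b set"
  define R where "R W = (SOME V. ref W V)" for W
  have R: "ref W (R W)" if W: "\<And>k. open (W k)" for W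
  proof -
    obtain V where "\<And>k. open (V k)" "\<And>k. V k \<subseteq> W k" "(\<Union>k. V k) = (\<Union>k. W k)"
      "\<And>x. finite {k. x \<in> V k}"
      by (rule point_finite_refinement[where W = W, OF W]) (rule that)
    then have "ref W V" unfolding ref_def by blast
    then show ?thesis unfolding R_def by (rule someI[of "ref W"])
  qed
  define O' where "O' = rec_list (U []) (\<lambda>k s Os. R (\<lambda>j. Os \<inter> U (j # s)) k)"
  have O_Nil: "O' [] = U []" and O_Cons: "O' (k # s) = R (\<lambda>j. O' s \<inter> U (j # s)) k" for k s
    by (simp_all add: O'_def)
  have opn: "open (O' s)" for s
  proof (induction s)
    case Nil show ?case by (simp add: O_Nil U)
  next
    case (Cons k s)
    have "ref (\<lambda>j. O' s \<inter> U (j # s)) (R (\<lambda>j. O' s \<inter> U (j # s)))"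
      using Cons U by (intro R open_Int)
    then show ?case by (simp add: O_Cons ref_def)
  qed
  have R': "(\<forall>k. O' (k # s) \<subseteq> O' s \<inter> U (k # s)) \<and> (\<Union>k. O' (k # s)) = (\<Union>k. O' s \<inter> U (k # s)) \<and>
    (\<forall>x. finite {k. x \<in> O' (k # s)})" for s
    unfolding O_Cons using R[of "\<lambda>j. O' s \<inter> U (j # s)", OF open_Int[OF opn U]]
    unfolding ref_def by blast
  have sub: "O' s \<subseteq> U s" for s
  proof (cases s)
    case Nil then show ?thesis by (simp add: O_Nil)
  next
    case (Cons k t) then show ?thesis using R'[of t] by blast
  qed
  define G where "G n = (\<Union>s\<in>{s. length s = n}. O' s)" for n
  show ?thesis
  proof (intro exI[of _ G] conjI allI impI)
    show "open (G n)" for n unfolding G_def using opn by blast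
    show "Y \<subseteq> G n" for n
    proof (induction n)
      case 0 show ?case using Y by (simp add: G_def O_Nil)
    next
      case (Suc n)
      show ?case
      proof
        fix y assume y: "y \<in> Y"
        then obtain s where s: "length s = n" "y \<in> O' s" using Suc by (auto simp: G_def)
        then obtain k where "y \<in> U (k # s)" using step[of s] y sub[of s] by blast
        then obtain k where "y \<in> O' (k # s)" using R'[of s] s by blast
        then show "y \<in> G (Suc n)" using s by (auto simp: G_def intro!: exI[of _ "k # s"])
      qed
    qed
    fix x assume x: "\<forall>n. x \<in> G n"
    define good where "good s \<longleftrightarrow> (\<forall>n. \<exists>t. length t = n \<and> x \<in> O' (t @ s))" for s
    have anti: "x \<in> O' s" if "x \<in> O' (t @ s)" for t s
      using that
  proof (induction t)
    case (Cons k t)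
    then have "x \<in> O' (k # (t @ s))" by simp
    then have "x \<in> O' (t @ s)" using R'[of "t @ s"] by blast
    then show ?case by (rule Cons.IH)
  qed simp
    have good0: "good []" using x by (force simp: good_def G_def)
    have goodS: "\<exists>k. good (k # s)" if gs: "good s" for s
    proof (rule ccontr)
      assume "\<not> ?thesis"
      then obtain m where m: "\<And>k t. length t = m k \<Longrightarrow> x \<notin> O' (t @ k # s)"
        unfolding good_def by metis
      define F where "F = {k. x \<in> O' (k # s)}"
      have fin: "finite F" using R' by (simp add: F_def)
      \<comment> \<open>None of the finitely many children has a descendant \<open>N\<close> levels further down.\<close>
      define N where "N = (\<Sum>k\<in>F. m k)"
      obtain t where t: "length t = Suc N" "x \<in> O' (t @ s)" using gs by (auto simp: good_def)
      then obtain k t' where t': "t = t' @ [k]" by (metis length_0_conv nat.distinct(1) rev_exhaust)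
      with t have k: "k \<in> F" using anti[of t' "k # s"] by (simp add: F_def)
      then have le: "m k \<le> N" unfolding N_def using fin by (simp add: member_le_sum)
      have len: "length t' = N" using t t' by simp
      have "t @ s = take (N - m k) t' @ (drop (N - m k) t' @ k # s)" using t' by simp
      then have "x \<in> O' (drop (N - m k) t' @ k # s)" using anti t by metis
      moreover have "length (drop (N - m k) t') = m k" using le len by simp
      ultimately show False using m by blast
    qed
    define \<sigma> where "\<sigma> = rec_nat [] (\<lambda>_ s. (SOME k. good (k # s)) # s)"
    have "good (\<sigma> n)" for n
      by (induction n) (auto simp: \<sigma>_def good0 intro: someI_ex goodS)
    then have "x \<in> U (\<sigma> n)" for n
      using sub unfolding good_def by (metis append_Nil length_0_conv subsetD)
    moreover have "branch \<sigma>" by (auto simp: branch_def \<sigma>_def)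
    ultimately show "\<exists>\<sigma>. branch \<sigma> \<and> (\<forall>n. x \<in> U (\<sigma> n))" by blast
  qed
qed

lemma compact_insert_UN_shrinking:
  fixes y :: "'b::metric_space"
  assumes L: "\<And>k. compact (L k)" and small: "\<And>k. L k \<subseteq> ball y (r / real (Suc k))"
  shows "compact (insert y (\<Union>k. L k))"
proof (rule compactI)
  fix \<C> assume \<C>: "\<forall>t\<in>\<C>. open t" "insert y (\<Union>k. L k) \<subseteq> \<Union>\<C>"
  then obtain C e where C: "C \<in> \<C>" "e > 0" "ball y e \<subseteq> C"
    by (metis UnionE insert_subset openE)
  obtain N where N: "r / e < real N" using reals_Archimedean2 by blast
  have tail: "L k \<subseteq> C" if "k \<ge> N" for k
  proof -
    have "r < e * real (Suc k)"
      using N that C(2) by (smt (verit) mult.commute of_nat_Suc of_nat_mono pos_divide_less_eq mult_less_cancel_left_pos)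
    then have "r / real (Suc k) < e" by (simp add: field_simps)
    then show ?thesis using small[of k] C(3) by fastforce
  qed
  have "compact (\<Union>k<N. L k)" using L by blast
  moreover have "(\<Union>k<N. L k) \<subseteq> \<Union>\<C>" using \<C>(2) by blast
  ultimately obtain \<D> where \<D>: "\<D> \<subseteq> \<C>" "finite \<D>" "(\<Union>k<N. L k) \<subseteq> \<Union>\<D>"
    using \<C>(1) by (metis compactE)
  have "insert y (\<Union>k. L k) \<subseteq> \<Union>(insert C \<D>)"
  proof
    fix z assume z: "z \<in> insert y (\<Union>k. L k)"
    show "z \<in> \<Union>(insert C \<D>)"
    proof (cases "z = y")
      case True
      then show ?thesis using C by auto
    next
      case False
      then obtain k where "z \<in> L k" using z by blast
      then show ?thesis using tail[of k] \<D>(3) by (cases "k < N") auto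
    qed
  qed
  then show "\<exists>\<C>'\<subseteq>\<C>. finite \<C>' \<and> insert y (\<Union>k. L k) \<subseteq> \<Union>\<C>'"
    using \<D> C by (intro exI[of _ "insert C \<D>"]) auto
qed

text \<open>The heart of the descent from functions to \<open>\<sigma>\<close>-compactness, as explained at the beginning.  The hypothesis \<open>dom\<close>
says that every compact set missing \<open>S\<close> is controlled by a function \<open>h p\<close>; \<open>bdd\<close> says that the sets
\<open>Q s\<close> shrink along branches so much that \<open>h (p n) x\<close> cannot outgrow \<open>n\<close>.\<close>

lemma sieve_of_dominating_functions:
  fixes K S :: "'b::metric_space set" and Q :: "nat list \<Rightarrow> 'p set" and h :: "'p \<Rightarrow> 'b \<Rightarrow> real"
  assumes K: "compact K" "S \<subseteq> K"
    and dom: "\<And>L. compact L \<Longrightarrow> L \<subseteq> K - S \<Longrightarrow> \<exists>p\<in>Q []. \<forall>x\<in>S. \<forall>y\<in>L. 1 \<le> h p x * dist x y"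
    and split: "\<And>s. Q s \<subseteq> (\<Union>k. Q (k # s))"
    and bdd: "\<And>\<sigma> p x. branch \<sigma> \<Longrightarrow> (\<And>n. p n \<in> Q (\<sigma> n)) \<Longrightarrow> x \<in> S \<Longrightarrow> \<exists>n. h (p n) x \<le> real n"
  obtains F :: "nat \<Rightarrow> 'b set" where "\<And>n. compact (F n)" "(\<Union>n. F n) = S"
proof -
  define Y where "Y = K - S"
  define D where "D s L \<longleftrightarrow> (\<exists>p\<in>Q s. \<forall>x\<in>S. \<forall>y\<in>L. 1 \<le> h p x * dist x y)" for s L
  define U where "U s = {x. \<exists>r>0. \<forall>L. compact L \<and> L \<subseteq> Y \<inter> ball x r \<longrightarrow> D s L}" for s
  have opn: "open (U s)" for s
  proof (rule openI)
    fix x assume "x \<in> U s"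
    then obtain r where r: "r > 0" "\<And>L. compact L \<Longrightarrow> L \<subseteq> Y \<inter> ball x r \<Longrightarrow> D s L"
      unfolding U_def by blast
    have "ball x (r/2) \<subseteq> U s"
    proof
      fix z assume z: "z \<in> ball x (r/2)"
      have "ball z (r/2) \<subseteq> ball x r"
      proof
        fix w assume "w \<in> ball z (r/2)"
        then show "w \<in> ball x r" using z dist_triangle[of x w z] by simp
      qed
      then show "z \<in> U s" unfolding U_def using r by (intro CollectI exI[of _ "r/2"]) auto
    qed
    then show "\<exists>e>0. ball x e \<subseteq> U s" using r(1) by (metis half_gt_zero)
  qed
  have base: "Y \<subseteq> U []"
  proof
    fix y assume "y \<in> Y"
    have "D [] L" if "compact L" "L \<subseteq> Y \<inter> ball y 1" for L
    proof -
      have "L \<subseteq> K - S" using that Y_def by blast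
      then show ?thesis unfolding D_def by (rule dom[OF that(1)])
    qed
    then show "y \<in> U []" unfolding U_def by (intro CollectI exI[of _ 1]) auto
  qed
  have step: "Y \<inter> U s \<subseteq> (\<Union>k. U (k # s))" for s
  proof
    fix y assume y: "y \<in> Y \<inter> U s"
    then obtain r where r: "r > 0" "\<And>L. compact L \<Longrightarrow> L \<subseteq> Y \<inter> ball y r \<Longrightarrow> D s L"
      unfolding U_def by blast
    show "y \<in> (\<Union>k. U (k # s))"
    proof (rule ccontr)
      assume "y \<notin> (\<Union>k. U (k # s))"
      then have "\<exists>L. compact L \<and> L \<subseteq> Y \<inter> ball y (r / real (Suc k)) \<and> \<not> D (k # s) L" for k
      proof -
        have "r / real (Suc k) > 0" "y \<notin> U (k # s)" using r(1) \<open>y \<notin> (\<Union>k. U (k # s))\<close> by auto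
        then show ?thesis unfolding U_def by blast
      qed
      then obtain L where L: "\<And>k. compact (L k)" "\<And>k. L k \<subseteq> Y \<inter> ball y (r / real (Suc k))"
        "\<And>k. \<not> D (k # s) (L k)" by metis
      \<comment> \<open>One function from \<open>Q s\<close> controls all the \<open>L k\<close> at once, but it lies in some \<open>Q (k # s)\<close>.\<close>
      define L' where "L' = insert y (\<Union>k. L k)"
      have "compact L'" unfolding L'_def
        by (rule compact_insert_UN_shrinking[of _ _ r]) (use L in auto)
      moreover have "L' \<subseteq> Y \<inter> ball y r"
      proof -
        have "ball y (r / real (Suc k)) \<subseteq> ball y r" for k
          using r(1) by (intro subset_ball) (simp add: field_simps)
        then have "L k \<subseteq> Y \<inter> ball y r" for k using L(2)[of k] by blast
        then show ?thesis unfolding L'_def using y r(1) by auto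
      qed
      ultimately have "D s L'" by (rule r(2))
      then obtain p where p: "p \<in> Q s" "\<forall>x\<in>S. \<forall>y\<in>L'. 1 \<le> h p x * dist x y"
        unfolding D_def by blast
      then obtain k where "p \<in> Q (k # s)" using split by blast
      then have "D (k # s) (L k)" unfolding D_def using p(2) by (intro bexI[of _ p]) (auto simp: L'_def)
      then show False using L(3) by blast
    qed
  qed
  obtain G :: "nat \<Rightarrow> 'b set" where G: "\<forall>n. open (G n)" "\<forall>n. Y \<subseteq> G n"
    "\<forall>x. (\<forall>n. x \<in> G n) \<longrightarrow> (\<exists>\<sigma>. branch \<sigma> \<and> (\<forall>n. x \<in> U (\<sigma> n)))"
    using sieve_Inter_open[where U = U and Y = Y, OF opn base step] by blast
  have key: "x \<notin> closure Y" if x: "x \<in> S" "\<forall>n. x \<in> G n" for x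
  proof
    assume cl: "x \<in> closure Y"
    obtain \<sigma> where \<sigma>: "branch \<sigma>" "\<And>n. x \<in> U (\<sigma> n)" using G(3) x by blast
    have "\<exists>p\<in>Q (\<sigma> n). h p x > real n" for n
    proof -
      obtain r where r: "r > 0" "\<And>L. compact L \<Longrightarrow> L \<subseteq> Y \<inter> ball x r \<Longrightarrow> D (\<sigma> n) L"
        using \<sigma>(2)[of n] unfolding U_def by blast
      define e where "e = min r (1 / real (Suc n))"
      have "e > 0" using r by (simp add: e_def)
      then obtain y where y: "y \<in> Y" "dist y x < e" using cl closure_approachable by blast
      then have "D (\<sigma> n) {y}" using r(2)[of "{y}"] by (simp add: e_def dist_commute)
      then obtain p where p: "p \<in> Q (\<sigma> n)" "1 \<le> h p x * dist x y" unfolding D_def using x by auto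
      have d: "0 < dist x y" using y x by (auto simp: Y_def)
      have "dist x y * real (Suc n) < 1" using y by (simp add: e_def dist_commute field_simps)
      then have "dist x y * real (Suc n) < dist x y * h p x" using p(2) by (simp add: mult.commute)
      then have "real (Suc n) < h p x" using d by (metis mult_less_cancel_left_pos)
      then show ?thesis using p by force
    qed
    then obtain p where "\<And>n. p n \<in> Q (\<sigma> n)" "\<And>n. h (p n) x > real n" by metis
    then show False using bdd[OF \<sigma>(1), of p x] x(1) by (meson not_less)
  qed
  have opY: "open (- closure Y)" by (intro open_Compl closed_closure)
  then obtain A :: "nat \<Rightarrow> 'b set" where A: "\<And>n. closed (A n)" "(\<Union>n. A n) = - closure Y"
  proof -
    have "fsigma_in euclidean (- closure Y)"
      using opY by (intro open_imp_fsigma_in metrizable_space_euclidean) simp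
    then obtain A :: "nat \<Rightarrow> 'b set" where "\<forall>n. closedin euclidean (A n)" "(\<Union>n. A n) = - closure Y"
      unfolding fsigma_in_ascending by blast
    then show thesis by (intro that[of A]) auto
  qed
  \<comment> \<open>The points of \<open>S\<close> outside the closure of \<open>Y\<close> and those outside some \<open>G n\<close>, listed alternately.\<close>
  define F where "F n = (if even n then K \<inter> A (n div 2) else K - G (n div 2))" for n
  show thesis
  proof
    show "compact (F n)" for n
      using K(1) A(1) G(1) by (auto simp: F_def compact_Int_closed compact_diff)
    show "(\<Union>n. F n) = S"
    proof (intro equalityI subsetI)
      fix x assume "x \<in> (\<Union>n. F n)"
      then obtain n where n: "x \<in> F n" by blast
      then have "x \<in> K" by (auto simp: F_def split: if_splits)
      moreover have "x \<notin> Y"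
      proof (cases "even n")
        case True
        then show ?thesis using n A(2) closure_subset by (auto simp: F_def)
      next
        case False
        then show ?thesis using n G(2) by (auto simp: F_def)
      qed
      ultimately show "x \<in> S" by (simp add: Y_def)
    next
      fix x assume x: "x \<in> S"
      then have xK: "x \<in> K" using K by blast
      show "x \<in> (\<Union>n. F n)"
      proof (cases "\<exists>n. x \<notin> G n")
        case True
        then obtain n where "x \<notin> G n" by blast
        then have "x \<in> F (2 * n + 1)" using xK by (simp add: F_def)
        then show ?thesis by blast
      next
        case False
        then have "x \<notin> closure Y" using key x by blast
        then obtain n where "x \<in> A n" using A(2) by blast
        then have "x \<in> F (2 * n)" using xK by (simp add: F_def)
        then show ?thesis by blast
      qed
    qed
  qed
qed

section \<open>Polish spaces and separable metrizable spaces\<close>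

lemma C_fun_restrict:
  assumes "continuous_map X euclideanreal f"
  shows "restrict f (topspace X) \<in> C_fun X"
  unfolding C_fun_def using assms by (auto intro: continuous_map_eq)

lemma (in Metric_space) continuous_map_d:
  "a \<in> M \<Longrightarrow> continuous_map mtopology euclideanreal (d a)"
  using continuous_on_mdist[of a Self] by (simp add: mtopology_of_def)

lemma (in Metric_space) dense_sequence:
  assumes "separable_space mtopology" "M \<noteq> {}"
  shows "\<exists>q :: nat \<Rightarrow> 'a. (\<forall>k. q k \<in> M) \<and> (\<forall>x r. x \<in> M \<longrightarrow> 0 < r \<longrightarrow> (\<exists>k. d (q k) x < r))"
proof -
  obtain C where C: "countable C" "C \<subseteq> M" "mtopology closure_of C = M"
    using assms unfolding separable_space_def by auto
  then have Cne: "C \<noteq> {}" using assms by auto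
  have "\<exists>k. d (from_nat_into C k) x < r" if xr: "x \<in> M" "r > 0" for x r
  proof -
    have "x \<in> mtopology closure_of C" using C xr by simp
    then obtain y where y: "y \<in> C" "y \<in> mball x r" using xr unfolding metric_closure_of by blast
    obtain k where "from_nat_into C k = y" using from_nat_into_surj[OF C(1) y(1)] by blast
    then show ?thesis using y by (auto simp: commute)
  qed
  then show ?thesis using from_nat_into[OF Cne] C(2) by (intro exI[of _ "from_nat_into C"]) blast
qed

text \<open>The sets \<open>Q s\<close> are finite intersections of balls around points of a dense sequence, the radii decreasing
along the tree.  They serve as a countable network of \<open>P\<close> and, by completeness, every selection
from a branch converges.\<close>

lemma Polish_sieve:
  assumes P: "Polish_space (P :: 'p topology)" and ne: "topspace P \<noteq> {}"
  shows "\<exists>Q :: nat list \<Rightarrow> 'p set. Q [] = topspace P \<and> (\<forall>s. Q s \<subseteq> (\<Union>k. Q (k # s))) \<and>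
    (\<forall>W x. openin P W \<longrightarrow> x \<in> W \<longrightarrow> (\<exists>s. x \<in> Q s \<and> Q s \<subseteq> W)) \<and>
    (\<forall>\<sigma> p. branch \<sigma> \<longrightarrow> (\<forall>n. p n \<in> Q (\<sigma> n)) \<longrightarrow> (\<exists>l. limitin P p l sequentially))"
proof -
  obtain M d where "Metric_space M d" and compl: "Metric_space.mcomplete M d"
    and Peq: "P = Metric_space.mtopology M d"
    using P unfolding Polish_space_def completely_metrizable_space_def by blast
  then interpret Metric_space M d by simp
  have "separable_space mtopology" "M \<noteq> {}" using P ne unfolding Peq Polish_space_def by auto
  from dense_sequence[OF this] obtain q :: "nat \<Rightarrow> _" where "\<forall>k. q k \<in> M"
    and "\<forall>x r. x \<in> M \<longrightarrow> 0 < r \<longrightarrow> (\<exists>k. d (q k) x < r)" by blast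
  then have q: "q k \<in> M" and dense: "x \<in> M \<Longrightarrow> 0 < r \<Longrightarrow> \<exists>k. d (q k) x < r" for k x r
    by auto
  define Q where "Q = rec_list M (\<lambda>k s A. A \<inter> mball (q k) (1 / real (Suc (length s))))"
  have Q_Nil: "Q [] = M" and Q_Cons: "Q (k # s) = Q s \<inter> mball (q k) (1 / real (Suc (length s)))" for k s
    by (simp_all add: Q_def)
  have QM: "Q s \<subseteq> M" for s by (induction s) (auto simp: Q_Nil Q_Cons)
  have split: "Q s \<subseteq> (\<Union>k. Q (k # s))" for s
  proof
    fix x assume x: "x \<in> Q s"
    then obtain k where "d (q k) x < 1 / real (Suc (length s))"
      using dense[of x "1 / real (Suc (length s))"] QM by auto
    then show "x \<in> (\<Union>k. Q (k # s))" using x QM q by (auto simp: Q_Cons)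
  qed
  have small: "d x y < 2 / real (Suc (length s))" if "x \<in> Q (k # s)" "y \<in> Q (k # s)" for x y k s
  proof -
    have "d (q k) x < 1 / real (Suc (length s))" "d (q k) y < 1 / real (Suc (length s))" "x \<in> M" "y \<in> M"
      using that by (auto simp: Q_Cons)
    moreover have "d x y \<le> d (q k) x + d (q k) y"
      using triangle'[of x "q k" y] \<open>x \<in> M\<close> \<open>y \<in> M\<close> q by (simp add: commute)
    ultimately have "d x y < 1 / real (Suc (length s)) + 1 / real (Suc (length s))" by linarith
    then show ?thesis by simp
  qed
  have ex: "\<exists>s. length s = n \<and> x \<in> Q s" if "x \<in> M" for x n
  proof (induction n)
    case 0 then show ?case using that by (auto simp: Q_Nil)
  next
    case (Suc n)
    then obtain s where "length s = n" "x \<in> Q s" by blast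
    moreover then obtain k where "x \<in> Q (k # s)" using split by blast
    ultimately show ?case by (intro exI[of _ "k # s"]) auto
  qed
  show ?thesis
  proof (intro exI[of _ Q] conjI allI impI)
    show "Q [] = topspace P" by (simp add: Q_Nil Peq)
    show "Q s \<subseteq> (\<Union>k. Q (k # s))" for s by (rule split)
  next
    fix W x assume W: "openin P W" "x \<in> W"
    then obtain r where r: "r > 0" "mball x r \<subseteq> W" and xM: "x \<in> M"
      unfolding Peq openin_mtopology by blast
    obtain N where N: "inverse (real (Suc N)) < r / 2" using r reals_Archimedean half_gt_zero by blast
    obtain k s where s: "length s = N" "x \<in> Q (k # s)"
      using ex[OF xM, of "Suc N"] by (metis length_Suc_conv)
    have "Q (k # s) \<subseteq> mball x r"
    proof
      fix y assume y: "y \<in> Q (k # s)"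
      have "d x y < 2 / real (Suc N)" using small[OF s(2) y] s(1) by simp
      also have "\<dots> < r" using N by (simp add: field_simps)
      finally show "y \<in> mball x r" using y QM xM by auto
    qed
    then show "\<exists>s. x \<in> Q s \<and> Q s \<subseteq> W" using s r by blast
  next
    fix \<sigma> and p :: "nat \<Rightarrow> 'p" assume \<sigma>: "branch \<sigma>" and p: "\<forall>n. p n \<in> Q (\<sigma> n)"
    have step: "Q (\<sigma> (Suc n)) \<subseteq> Q (\<sigma> n)" for n
      using \<sigma> unfolding branch_def by (metis Int_lower1 Q_Cons)
    have mono: "p m \<in> Q (\<sigma> n)" if "n \<le> m" for m n
      using p lift_Suc_antimono_le[of "\<lambda>n. Q (\<sigma> n)", OF step that] by blast
    have "MCauchy p"
      unfolding MCauchy_def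
    proof (intro conjI allI impI)
      show "range p \<subseteq> M" using p QM by blast
      fix e :: real assume "e > 0"
      then obtain N where N: "inverse (real (Suc N)) < e / 2" using reals_Archimedean half_gt_zero by blast
      obtain k where k: "\<sigma> (Suc N) = k # \<sigma> N" using \<sigma> unfolding branch_def by blast
      have "d (p n) (p n') < e" if "Suc N \<le> n" "Suc N \<le> n'" for n n'
      proof -
        have "d (p n) (p n') < 2 / real (Suc N)"
          using small[of "p n" k "\<sigma> N" "p n'"] mono[OF that(1)] mono[OF that(2)] branch_length[OF \<sigma>] k by simp
        also have "\<dots> < e" using N by (simp add: field_simps)
        finally show ?thesis .
      qed
      then show "\<exists>N. \<forall>n n'. N \<le> n \<longrightarrow> N \<le> n' \<longrightarrow> d (p n) (p n') < e" by blast
    qed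
    then show "\<exists>l. limitin P p l sequentially" using compl unfolding Peq mcomplete_def by blast
  qed
qed

text \<open>The distances to the points of a dense sequence, cut off at \<open>1\<close>, are coordinates in a countable power of the unit interval.\<close>

lemma separable_metrizable_embeds_in_cube:
  assumes X: "metrizable_space (X :: 'a topology)" "separable_space X" and ne: "topspace X \<noteq> {}"
  obtains e :: "'a \<Rightarrow> nat \<Rightarrow> real" and K where "embedding_map X euclidean e" "compact K" "e ` topspace X \<subseteq> K"
proof -
  obtain M d where "Metric_space M d" and Xeq: "X = Metric_space.mtopology M d"
    using X unfolding metrizable_space_def by blast
  then interpret Metric_space M d by simp
  have "separable_space mtopology" "M \<noteq> {}" using X ne unfolding Xeq by auto
  from dense_sequence[OF this] obtain q :: "nat \<Rightarrow> _" where "\<forall>k. q k \<in> M"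
    and "\<forall>x r. x \<in> M \<longrightarrow> 0 < r \<longrightarrow> (\<exists>k. d (q k) x < r)" by blast
  then have q: "q k \<in> M" and dense: "x \<in> M \<Longrightarrow> 0 < r \<Longrightarrow> \<exists>k. d (q k) x < r" for k x r
    by auto
  define e where "e x n = min 1 (d (q n) x)" for x n
  have near: "\<exists>n. e x n < r / 2 \<and> (\<forall>y\<in>M. e y n < r / 2 \<longrightarrow> d x y < r)" if x: "x \<in> M" "0 < r" "r \<le> 1" for x r
  proof -
    obtain n where n: "d (q n) x < r / 2" using dense[of x "r/2"] x by auto
    have "d x y < r" if "y \<in> M" "e y n < r / 2" for y
    proof -
      have "d (q n) y < r / 2" using that x by (auto simp: e_def)
      then show ?thesis using n triangle'[of x "q n" y] q that(1) x(1) by (simp add: commute)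
    qed
    moreover have "e x n < r / 2" using n by (simp add: e_def)
    ultimately show ?thesis by blast
  qed
  have cont: "continuous_map X euclidean e"
  proof -
    have "continuous_map mtopology euclideanreal (\<lambda>x. e x n)" for n
      unfolding e_def using q by (intro continuous_intros continuous_map_d) auto
    then have "continuous_map X (product_topology (\<lambda>i. euclideanreal) UNIV) e"
      unfolding continuous_map_componentwise_UNIV Xeq by blast
    then show ?thesis by (simp add: euclidean_product_topology)
  qed
  have inj: "inj_on e M"
  proof (rule inj_onI, rule ccontr)
    fix x y assume xy: "x \<in> M" "y \<in> M" "e x = e y" "x \<noteq> y"
    then have "d x y > 0" by simp
    then obtain n where "e x n < min 1 (d x y) / 2" "\<forall>z\<in>M. e z n < min 1 (d x y) / 2 \<longrightarrow> d x z < min 1 (d x y)"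
      using near[of x "min 1 (d x y)"] xy by auto
    then have "d x y < min 1 (d x y)" using xy by auto
    then show False by simp
  qed
  have "homeomorphic_map X (subtopology euclidean (e ` topspace X)) e"
  proof (rule bijective_open_imp_homeomorphic_map)
    show "continuous_map X (subtopology euclidean (e ` topspace X)) e"
      using cont by (simp add: continuous_map_in_subtopology)
    show "open_map X (subtopology euclidean (e ` topspace X)) e"
      unfolding open_map_def
    proof (intro allI impI)
      fix U assume U: "openin X U"
      show "openin (subtopology euclidean (e ` topspace X)) (e ` U)"
        unfolding openin_subopen[of _ "e ` U"]
      proof
        fix z assume "z \<in> e ` U"
        then obtain x where x: "x \<in> U" "z = e x" by blast
        then obtain r where r: "r > 0" "mball x r \<subseteq> U" and xM: "x \<in> M"
          using U unfolding Xeq openin_mtopology by blast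
        obtain n where n: "e x n < min 1 r / 2" "\<forall>y\<in>M. e y n < min 1 r / 2 \<longrightarrow> d x y < min 1 r"
          using near[of x "min 1 r"] xM r by auto
        define W where "W = {g :: nat \<Rightarrow> real. g n < min 1 r / 2}"
        have "open W" unfolding W_def
          by (intro open_Collect_less continuous_intros) (simp add: continuous_on_product_coordinates)
        then have "openin (subtopology euclidean (e ` topspace X)) (e ` topspace X \<inter> W)"
          by (simp add: openin_open_Int)
        moreover have "e ` topspace X \<inter> W \<subseteq> e ` U"
        proof
          fix w assume "w \<in> e ` topspace X \<inter> W"
          then obtain y where y: "y \<in> M" "w = e y" "e y n < min 1 r / 2" by (auto simp: W_def Xeq)
          then have "y \<in> mball x r" using n xM by auto
          then show "w \<in> e ` U" using r y by blast
        qed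
        moreover have "z \<in> e ` topspace X \<inter> W" using x n xM by (auto simp: W_def Xeq)
        ultimately show "\<exists>T. openin (subtopology euclidean (e ` topspace X)) T \<and> z \<in> T \<and> T \<subseteq> e ` U"
          by blast
      qed
    qed
    show "inj_on e (topspace X)" using inj by (simp add: Xeq)
  qed simp
  then have emb: "embedding_map X euclidean e" by (simp add: embedding_map_def)
  have "compactin (product_topology (\<lambda>_::nat. euclideanreal) UNIV) (PiE UNIV (\<lambda>_. {0..1}))"
    by (subst compactin_PiE) simp
  then have "compact (PiE UNIV (\<lambda>_::nat. {0..1::real}))" by (simp add: euclidean_product_topology)
  moreover have "e ` topspace X \<subseteq> PiE UNIV (\<lambda>_. {0..1})" by (auto simp: e_def)
  ultimately show thesis using emb that by blast
qed

section \<open>Suslin function spaces force \<open>\<sigma>\<close>-compactness\<close>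

text \<open>For a piece \<open>Q s\<close> of \<open>P\<close> let \<open>N s\<close> be the set of points at which all functions from \<open>Q s\<close> are below
\<open>-1/2\<close>.  These sets are a network: the function \<open>d x y / r - 1\<close> of \<open>y\<close> is \<open>-1\<close> at \<open>x\<close> and below \<open>-1/2\<close>
only near \<open>x\<close>, and the functions close to it at the point \<open>x\<close> contain the image of a piece.  One point from each
nonempty \<open>N s\<close> gives a dense set.\<close>

lemma separable_if_Suslin_function_space:
  assumes X: "metrizable_space (X :: 'a topology)" and T: "Suslin_space T" "topspace T = C_fun X"
    and open_less: "\<And>x r. x \<in> topspace X \<Longrightarrow> openin T {f \<in> C_fun X. f x < r}"
  shows "separable_space X"
proof -
  obtain M d where "Metric_space M d" and Xeq: "X = Metric_space.mtopology M d"
    using X unfolding metrizable_space_def by blast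
  then interpret Metric_space M d by simp
  obtain P :: "(nat \<Rightarrow> real) topology" and t where P: "Polish_space P" and t: "continuous_map P T t"
    and onto: "t ` topspace P = C_fun X"
    using T unfolding Suslin_space_def by auto
  have "restrict (\<lambda>_. 0) (topspace X) \<in> C_fun X" by (rule C_fun_restrict) simp
  then have ne: "topspace P \<noteq> {}" using onto by auto
  obtain Q :: "nat list \<Rightarrow> (nat \<Rightarrow> real) set" where
    Q: "\<forall>W x. openin P W \<longrightarrow> x \<in> W \<longrightarrow> (\<exists>s. x \<in> Q s \<and> Q s \<subseteq> W)"
    using Polish_sieve[OF P ne] by (elim exE conjE) (rule that)
  define N where "N s = {x \<in> M. \<forall>p\<in>Q s. t p x < - (1/2)}" for s
  define D where "D = (\<lambda>s. SOME x. x \<in> N s) ` {s. N s \<noteq> {}}"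
  have pick: "(SOME x. x \<in> N s) \<in> N s" if "N s \<noteq> {}" for s
    using that by (simp add: some_in_eq)
  have "countable D" by (simp add: D_def)
  moreover have "D \<subseteq> topspace X" using pick by (auto simp: D_def N_def Xeq)
  moreover have "X closure_of D = topspace X"
  proof (rule antisym)
    show "topspace X \<subseteq> X closure_of D"
    proof
      fix x assume "x \<in> topspace X"
      then have x: "x \<in> M" by (simp add: Xeq)
      have "\<exists>y\<in>D. y \<in> mball x r" if "r > 0" for r
      proof -
        define f where "f = restrict (\<lambda>y. d x y / r - 1) (topspace X)"
        have "continuous_map mtopology euclideanreal (\<lambda>y. d x y / r - 1)"
          using that x by (intro continuous_intros continuous_map_d) auto
        then have "f \<in> C_fun X" unfolding f_def Xeq by (rule C_fun_restrict)
        then obtain p where p: "p \<in> topspace P" "t p = f" using onto by (metis imageE)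
        define W where "W = {q \<in> topspace P. t q \<in> {g \<in> C_fun X. g x < - (1/2)}}"
        have "openin P W" unfolding W_def
          using t x by (intro openin_continuous_map_preimage[OF t] open_less) (simp add: Xeq)
        moreover have "p \<in> W"
          using p x \<open>f \<in> C_fun X\<close> by (simp add: W_def f_def Xeq)
        ultimately obtain s where s: "p \<in> Q s" "Q s \<subseteq> W" using Q by blast
        then have "x \<in> N s" using x by (auto simp: N_def W_def)
        then have ne: "N s \<noteq> {}" by blast
        define y where "y = (SOME x. x \<in> N s)"
        have "y \<in> N s" using pick[OF ne] by (simp add: y_def)
        then have y: "y \<in> M" "f y < - (1/2)" using s p by (auto simp: N_def)
        then have "d x y / r - 1 < - (1/2)" by (simp add: f_def Xeq)
        then have "d x y / r < 1 / 2" by linarith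
        then have "d x y < r" using that by (simp add: field_simps)
        moreover have "y \<in> D" using ne by (auto simp: D_def y_def)
        ultimately show ?thesis using x y by auto
      qed
      then show "x \<in> X closure_of D" using x unfolding Xeq metric_closure_of by blast
    qed
  qed (rule closure_of_subset_topspace)
  ultimately show ?thesis unfolding separable_space_def by blast
qed

text \<open>The pieces \<open>Q s\<close> of \<open>P\<close> and the functions \<open>t p\<close> satisfy the hypotheses of
\<open>sieve_of_dominating_functions\<close>: a compact set \<open>L\<close> outside the image of \<open>X\<close> is controlled by the reciprocal of the
distance to \<open>L\<close>, and along a branch the selected points converge, so that the values of the functions at a
fixed point are bounded above by upper semicontinuity of evaluation.\<close>

theorem sigma_compact_if_Suslin_function_space:
  assumes X: "metrizable_space (X :: 'a topology)" and T: "Suslin_space T" "topspace T = C_fun X"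
    and open_less: "\<And>x r. x \<in> topspace X \<Longrightarrow> openin T {f \<in> C_fun X. f x < r}"
  shows "sigma_compact_space X"
proof (cases "topspace X = {}")
  case True
  then show ?thesis by (simp add: sigma_compact_space_def)
next
  case False
  have sep: "separable_space X" using assms by (rule separable_if_Suslin_function_space)
  obtain e :: "'a \<Rightarrow> nat \<Rightarrow> real" and K where e: "embedding_map X euclidean e"
    and K: "compact K" "e ` topspace X \<subseteq> K"
    using separable_metrizable_embeds_in_cube[OF X sep False] by metis
  define S where "S = e ` topspace X"
  define e' where "e' = inv_into (topspace X) e"
  have hom: "homeomorphic_map X (subtopology euclidean S) e"
    using e by (simp add: embedding_map_def S_def)
  have inj: "inj_on e (topspace X)" using hom homeomorphic_imp_injective_map by blast
  have e'e: "e' (e x) = x" if "x \<in> topspace X" for x using inj that by (simp add: e'_def)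
  have econt: "continuous_map X euclidean e"
    using homeomorphic_imp_continuous_map[OF hom] by (simp add: continuous_map_in_subtopology)
  obtain P :: "(nat \<Rightarrow> real) topology" and t where P: "Polish_space P" and t: "continuous_map P T t"
    and onto: "t ` topspace P = C_fun X"
    using T unfolding Suslin_space_def by auto
  have zero: "restrict (\<lambda>_. 0) (topspace X) \<in> C_fun X" by (rule C_fun_restrict) simp
  then have ne: "topspace P \<noteq> {}" using onto by auto
  obtain Q :: "nat list \<Rightarrow> (nat \<Rightarrow> real) set" where
    Q: "Q [] = topspace P" "\<forall>s. Q s \<subseteq> (\<Union>k. Q (k # s))"
    "\<forall>\<sigma> p. branch \<sigma> \<longrightarrow> (\<forall>n. p n \<in> Q (\<sigma> n)) \<longrightarrow> (\<exists>l. limitin P p l sequentially)"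
    using Polish_sieve[OF P ne] by (elim exE conjE) (rule that)
  define h where "h p y = t p (e' y)" for p y
  have dom: "\<exists>p\<in>Q []. \<forall>x\<in>S. \<forall>y\<in>L. 1 \<le> h p x * dist x y" if L: "compact L" "L \<subseteq> K - S" for L
  proof (cases "L = {}")
    case True
    obtain p where "p \<in> topspace P" using ne by blast
    then show ?thesis using True Q(1) by blast
  next
    case False
    have pos: "infdist (e x) L > 0" if "x \<in> topspace X" for x
      using that L False by (intro infdist_pos_not_in_closed compact_imp_closed) (auto simp: S_def)
    have "continuous_map X euclideanreal (\<lambda>x. infdist (e x) L)"
    proof -
      have "continuous_map X euclideanreal ((\<lambda>z. infdist z L) \<circ> e)"
        by (rule continuous_map_compose[OF econt]) (simp add: continuous_on_infdist)
      then show ?thesis by (simp add: o_def)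
    qed
    then have "continuous_map X euclideanreal (\<lambda>x. inverse (infdist (e x) L))"
      using pos by (intro continuous_map_real_inverse) (auto simp: less_imp_neq[symmetric] dest: pos)
    then obtain p where p: "p \<in> topspace P" "t p = restrict (\<lambda>x. inverse (infdist (e x) L)) (topspace X)"
      using C_fun_restrict onto by (metis imageE)
    have "1 \<le> h p x * dist x y" if "x \<in> S" "y \<in> L" for x y
    proof -
      obtain u where u: "u \<in> topspace X" "x = e u" using \<open>x \<in> S\<close> by (auto simp: S_def)
      have hp: "h p x = inverse (infdist x L)" using u by (simp add: h_def e'e p(2))
      moreover have "infdist x L \<le> dist x y" using that by (intro infdist_le)
      moreover have ip: "infdist x L > 0" using pos u by simp
      ultimately have "h p x * infdist x L \<le> h p x * dist x y" by (intro mult_left_mono) auto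
      then show ?thesis using hp ip by simp
    qed
    then show ?thesis using p Q(1) by blast
  qed
  have bdd: "\<exists>n. h (p n) x \<le> real n" if \<sigma>: "branch \<sigma>" and p: "\<And>n. p n \<in> Q (\<sigma> n)" and x: "x \<in> S" for \<sigma> p x
  proof -
    obtain l where l: "limitin P p l sequentially" using Q(3) \<sigma> p by blast
    obtain u where u: "u \<in> topspace X" "x = e u" using x by (auto simp: S_def)
    define W where "W = {q \<in> topspace P. t q \<in> {g \<in> C_fun X. g u < t l u + 1}}"
    have "openin P W" unfolding W_def
      by (intro openin_continuous_map_preimage[OF t] open_less u(1))
    moreover have "l \<in> W" using l onto by (auto simp: W_def limitin_sequentially)
    ultimately obtain N where N: "\<And>n. n \<ge> N \<Longrightarrow> p n \<in> W" using l unfolding limitin_sequentially by blast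
    obtain m where m: "t l u + 1 \<le> real m" using real_arch_simple by blast
    have "t (p (max N m)) u < t l u + 1" using N[of "max N m"] by (simp add: W_def)
    then have "h (p (max N m)) x \<le> real (max N m)" using m u by (simp add: h_def e'e)
    then show ?thesis by blast
  qed
  obtain F :: "nat \<Rightarrow> (nat \<Rightarrow> real) set" where F: "\<And>n. compact (F n)" "(\<Union>n. F n) = S"
  proof (rule sieve_of_dominating_functions[where K = K and S = S and Q = Q and h = h])
    show "S \<subseteq> K" using K by (simp add: S_def)
    show "compact K" by (rule K(1))
    show "Q s \<subseteq> (\<Union>k. Q (k # s))" for s using Q(2) by blast
    show "\<exists>p\<in>Q []. \<forall>x\<in>S. \<forall>y\<in>L. 1 \<le> h p x * dist x y" if "compact L" "L \<subseteq> K - S" for L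
      using that by (rule dom)
    show "\<exists>n. h (p n) x \<le> real n" if "branch \<sigma>" "\<And>n. p n \<in> Q (\<sigma> n)" "x \<in> S" for \<sigma> p x
      using that by (rule bdd)
  qed (rule that)
  have "compactin X (topspace X \<inter> e -` F n)" for n
  proof -
    have sub: "F n \<subseteq> S" using F by blast
    then have img: "e ` (topspace X \<inter> e -` F n) = F n" by (auto simp: S_def)
    have "compactin (subtopology euclidean S) (F n)" using F sub by (simp add: compactin_subtopology)
    then show ?thesis using homeomorphic_map_compactness[OF hom, of "topspace X \<inter> e -` F n"] img by auto
  qed
  moreover have "(\<Union>n. topspace X \<inter> e -` F n) = topspace X" using F(2) unfolding S_def by blast
  ultimately show ?thesis unfolding sigma_compact_space_def union_of_def
    by (intro exI[of _ "range (\<lambda>n. topspace X \<inter> e -` F n)"]) auto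
qed

section \<open>Recording moduli of continuity on a \<open>\<sigma>\<close>-compact space\<close>

lemma (in Metric_space) continuous_map_realD:
  assumes "continuous_map mtopology euclideanreal f" "x \<in> M" "\<epsilon> > 0"
  shows "\<exists>\<delta>>0. \<forall>y\<in>M. d x y < \<delta> \<longrightarrow> \<bar>f x - f y\<bar> < \<epsilon>"
proof -
  have "openin mtopology {y \<in> topspace mtopology. f y \<in> ball (f x) \<epsilon>}"
    using assms(1) by (rule openin_continuous_map_preimage) simp
  then obtain \<delta> where "\<delta> > 0" "mball x \<delta> \<subseteq> {y \<in> topspace mtopology. f y \<in> ball (f x) \<epsilon>}"
    using assms unfolding openin_mtopology by auto
  then show ?thesis using assms(2) by (intro exI[of _ \<delta>]) (auto simp: dist_real_def)
qed

lemma (in Metric_space) continuous_map_realI: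
  assumes "\<And>x \<epsilon>. x \<in> M \<Longrightarrow> \<epsilon> > 0 \<Longrightarrow> \<exists>\<delta>>0. \<forall>y\<in>M. d x y < \<delta> \<longrightarrow> \<bar>f x - f y\<bar> < \<epsilon>"
  shows "continuous_map mtopology euclideanreal f"
  unfolding mtopology_is_euclidean[symmetric] Met_TC.continuous_map_to_metric
proof (intro ballI allI impI)
  fix x \<epsilon> assume x: "x \<in> topspace mtopology" "(0::real) < \<epsilon>"
  then obtain \<delta> where "\<delta> > 0" "\<forall>y\<in>M. d x y < \<delta> \<longrightarrow> \<bar>f x - f y\<bar> < \<epsilon>" using assms[of x \<epsilon>] by auto
  then show "\<exists>U. openin mtopology U \<and> x \<in> U \<and> (\<forall>y\<in>U. f y \<in> Met_TC.mball (f x) \<epsilon>)"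
    using x by (intro exI[of _ "mball x \<delta>"]) (auto simp: dist_real_def)
qed

text \<open>Only one of the two points is confined to the compact set.\<close>

lemma (in Metric_space) uniform_continuity_at_compact:
  assumes L: "compactin mtopology L" and f: "continuous_map mtopology euclideanreal f" and e: "\<epsilon> > 0"
  shows "\<exists>\<delta>>0. \<forall>x\<in>L. \<forall>y\<in>M. d x y < \<delta> \<longrightarrow> \<bar>f x - f y\<bar> \<le> \<epsilon>"
proof -
  define U where "U c = {y \<in> topspace mtopology. f y \<in> ball c (\<epsilon> / 2)}" for c
  have "openin mtopology (U c)" for c
    unfolding U_def using f by (rule openin_continuous_map_preimage) simp
  moreover have "L \<subseteq> \<Union>(range U)"
  proof
    fix x assume "x \<in> L"
    then have "x \<in> U (f x)" using compactin_subset_topspace[OF L] e unfolding U_def by auto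
    then show "x \<in> \<Union>(range U)" by blast
  qed
  ultimately have "\<exists>\<delta>>0. \<forall>x\<in>L. \<exists>V\<in>range U. mball x \<delta> \<subseteq> V"
    by (intro lebesgue_number[OF L]) auto
  then obtain \<delta> where \<delta>: "\<delta> > 0" "\<forall>x\<in>L. \<exists>V\<in>range U. mball x \<delta> \<subseteq> V" by blast
  have "\<bar>f x - f y\<bar> \<le> \<epsilon>" if xy: "x \<in> L" "y \<in> M" "d x y < \<delta>" for x y
  proof -
    obtain c where c: "mball x \<delta> \<subseteq> U c" using \<delta>(2) xy(1) by blast
    have "x \<in> M" using compactin_subset_topspace[OF L] xy(1) by auto
    then have "x \<in> U c" "y \<in> U c" using c xy \<delta>(1) by auto
    then have "\<bar>c - f x\<bar> < \<epsilon> / 2" "\<bar>c - f y\<bar> < \<epsilon> / 2" by (auto simp: U_def dist_real_def)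
    then show ?thesis by linarith
  qed
  then show ?thesis using \<delta>(1) by blast
qed

text \<open>If the oscillation of \<open>h\<close> at every point of the space tends to zero, then \<open>h\<close> converges along every sequence of
\<open>q\<close>-points that approaches a given point, and the limits define the extension.\<close>

lemma (in Metric_space) continuous_extension_from_dense_sequence:
  fixes h :: "nat \<Rightarrow> real"
  assumes q: "\<And>i. q i \<in> M" and dense: "\<And>x r. x \<in> M \<Longrightarrow> 0 < r \<Longrightarrow> \<exists>i. d x (q i) < r"
    and osc: "\<And>x \<epsilon>. x \<in> M \<Longrightarrow> 0 < \<epsilon> \<Longrightarrow>
      \<exists>\<delta>>0. \<forall>i j. d x (q i) < \<delta> \<longrightarrow> d x (q j) < \<delta> \<longrightarrow> \<bar>h i - h j\<bar> \<le> \<epsilon>"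
  shows "\<exists>f. continuous_map mtopology euclideanreal f \<and> (\<forall>i. f (q i) = h i)"
proof -
  have ex: "\<exists>y. \<forall>\<epsilon>>0. \<exists>\<delta>>0. \<forall>j. d x (q j) < \<delta> \<longrightarrow> \<bar>y - h j\<bar> \<le> \<epsilon>" if x: "x \<in> M" for x
  proof -
    have "\<forall>l. \<exists>i. d x (q i) < 1 / real (Suc l)" using dense[OF x] by simp
    then obtain s where s: "\<And>l. d x (q (s l)) < 1 / real (Suc l)" by metis
    have ev: "\<exists>L. \<forall>l\<ge>L. d x (q (s l)) < \<delta>" if pos: "\<delta> > 0" for \<delta>
    proof -
      obtain N where N: "inverse (real (Suc N)) < \<delta>" using pos reals_Archimedean by blast
      have "d x (q (s l)) < \<delta>" if "l \<ge> N" for l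
      proof -
        have "1 / real (Suc l) \<le> inverse (real (Suc N))" using that by (simp add: field_simps)
        then show ?thesis using s[of l] N by linarith
      qed
      then show ?thesis by blast
    qed
    have "Cauchy (\<lambda>l. h (s l))"
    proof (rule metric_CauchyI)
      fix e :: real assume "e > 0"
      then obtain \<delta> where \<delta>: "\<delta> > 0" "\<forall>i j. d x (q i) < \<delta> \<longrightarrow> d x (q j) < \<delta> \<longrightarrow> \<bar>h i - h j\<bar> \<le> e / 2"
        using osc[OF x half_gt_zero[OF \<open>e > 0\<close>]] by blast
      obtain L where L: "\<forall>l\<ge>L. d x (q (s l)) < \<delta>" using ev[OF \<delta>(1)] by blast
      have "dist (h (s m)) (h (s n)) < e" if "m \<ge> L" "n \<ge> L" for m n
      proof -
        have "\<bar>h (s m) - h (s n)\<bar> \<le> e / 2" using \<delta>(2) L that by blast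
        then show ?thesis using \<open>e > 0\<close> by (simp add: dist_real_def)
      qed
      then show "\<exists>L. \<forall>m\<ge>L. \<forall>n\<ge>L. dist (h (s m)) (h (s n)) < e" by blast
    qed
    then obtain y where y: "(\<lambda>l. h (s l)) \<longlonglongrightarrow> y" using Cauchy_convergent convergent_def by blast
    have "\<exists>\<delta>>0. \<forall>j. d x (q j) < \<delta> \<longrightarrow> \<bar>y - h j\<bar> \<le> \<epsilon>" if "\<epsilon> > 0" for \<epsilon>
    proof -
      obtain \<delta> where \<delta>: "\<delta> > 0" "\<forall>i j. d x (q i) < \<delta> \<longrightarrow> d x (q j) < \<delta> \<longrightarrow> \<bar>h i - h j\<bar> \<le> \<epsilon>"
        using osc[OF x \<open>\<epsilon> > 0\<close>] by blast
      obtain L where L: "\<forall>l\<ge>L. d x (q (s l)) < \<delta>" using ev[OF \<delta>(1)] by blast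
      have "\<bar>y - h j\<bar> \<le> \<epsilon>" if "d x (q j) < \<delta>" for j
      proof (rule LIMSEQ_le_const2)
        show "(\<lambda>l. \<bar>h (s l) - h j\<bar>) \<longlonglongrightarrow> \<bar>y - h j\<bar>" using y by (intro tendsto_intros)
        show "\<exists>N. \<forall>n\<ge>N. \<bar>h (s n) - h j\<bar> \<le> \<epsilon>" using \<delta>(2) L that by blast
      qed
      then show ?thesis using \<delta>(1) by blast
    qed
    then show ?thesis by blast
  qed
  define f where "f x = (SOME y. \<forall>\<epsilon>>0. \<exists>\<delta>>0. \<forall>j. d x (q j) < \<delta> \<longrightarrow> \<bar>y - h j\<bar> \<le> \<epsilon>)" for x
  have f: "\<exists>\<delta>>0. \<forall>j. d x (q j) < \<delta> \<longrightarrow> \<bar>f x - h j\<bar> \<le> \<epsilon>" if "x \<in> M" "\<epsilon> > 0" for x \<epsilon>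
    using someI_ex[OF ex[OF that(1)], folded f_def] that(2) by blast
  have fq: "f (q i) = h i" for i
  proof -
    have "\<bar>f (q i) - h i\<bar> \<le> \<epsilon>" if pos: "\<epsilon> > 0" for \<epsilon>
    proof -
      obtain \<delta> where "\<delta> > 0" "\<forall>j. d (q i) (q j) < \<delta> \<longrightarrow> \<bar>f (q i) - h j\<bar> \<le> \<epsilon>" using f[OF q[of i] pos] by blast
      moreover have "d (q i) (q i) = 0" using q by simp
      ultimately show ?thesis by metis
    qed
    then have "\<bar>f (q i) - h i\<bar> \<le> 0" by (rule field_le_epsilon) auto
    then show ?thesis by simp
  qed
  have "continuous_map mtopology euclideanreal f"
  proof (rule continuous_map_realI)
    fix x \<epsilon> assume x: "x \<in> M" "(0::real) < \<epsilon>"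
    then obtain \<delta> where \<delta>: "\<delta> > 0" "\<forall>j. d x (q j) < \<delta> \<longrightarrow> \<bar>f x - h j\<bar> \<le> \<epsilon> / 3"
      using f[of x "\<epsilon> / 3"] by auto
    have "\<bar>f x - f y\<bar> < \<epsilon>" if y: "y \<in> M" "d x y < \<delta> / 2" for y
    proof -
      obtain \<eta> where \<eta>: "\<eta> > 0" "\<forall>j. d y (q j) < \<eta> \<longrightarrow> \<bar>f y - h j\<bar> \<le> \<epsilon> / 3"
        using f[of y "\<epsilon> / 3"] x y by auto
      obtain j where j: "d y (q j) < min \<eta> (\<delta> / 2)" using dense[of y "min \<eta> (\<delta> / 2)"] \<eta> \<delta> y by auto
      have "d x (q j) < \<delta>" using triangle[OF x(1) y(1) q[of j]] j y by linarith
      then have "\<bar>f x - h j\<bar> \<le> \<epsilon> / 3" "\<bar>f y - h j\<bar> \<le> \<epsilon> / 3" using \<delta> \<eta> j by auto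
      then show ?thesis using x(2) by linarith
    qed
    then show "\<exists>\<delta>>0. \<forall>y\<in>M. d x y < \<delta> \<longrightarrow> \<bar>f x - f y\<bar> < \<epsilon>" using half_gt_zero[OF \<delta>(1)] by blast
  qed
  then show ?thesis using fq by blast
qed

locale compact_exhaustion = Metric_space M d for M :: "'a set" and d +
  fixes K :: "nat \<Rightarrow> 'a set" and q :: "nat \<Rightarrow> 'a"
  assumes K_compact: "\<And>n. compactin mtopology (K n)" and K_cover: "(\<Union>n. K n) = M"
    and q_in: "\<And>i. q i \<in> M" and q_dense: "\<And>n x r. x \<in> K n \<Longrightarrow> 0 < r \<Longrightarrow> \<exists>i. q i \<in> K n \<and> d x (q i) < r"
begin

lemma K_subset: "K n \<subseteq> M" using K_cover by blast

lemma dense: "x \<in> M \<Longrightarrow> 0 < r \<Longrightarrow> \<exists>i. d x (q i) < r"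
  using q_dense K_cover by blast

text \<open>The pair \<open>e = (n, m)\<close> stands for the compact set \<open>K n\<close> and the tolerance \<open>1/(m+1)\<close>, and \<open>r\<close> is the reciprocal
of a radius.  Reals are allowed for \<open>r\<close>, and no division by \<open>r\<close> occurs, so that the condition depends on \<open>r\<close>
in a closed way when \<open>r\<close> becomes a coordinate of a point in a product space.\<close>

definition modulus :: "nat \<times> nat \<Rightarrow> real \<Rightarrow> ('a \<Rightarrow> real) \<Rightarrow> bool" where
  "modulus e r f \<longleftrightarrow> (\<forall>x\<in>K (fst e). \<forall>y\<in>M. r * d x y < 1 \<longrightarrow> \<bar>f x - f y\<bar> \<le> 1 / real (Suc (snd e)))"

definition modulus_seq :: "nat \<times> nat \<Rightarrow> real \<Rightarrow> (nat \<Rightarrow> real) \<Rightarrow> bool" where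
  "modulus_seq e r h \<longleftrightarrow> (\<forall>i j. q i \<in> K (fst e) \<longrightarrow> r * d (q i) (q j) < 1 \<longrightarrow> \<bar>h i - h j\<bar> \<le> 1 / real (Suc (snd e)))"

text \<open>A strict failure of the condition persists under small changes of the two points, so it is already visible on the dense sequence.\<close>

lemma modulus_iff_seq:
  assumes f: "continuous_map mtopology euclideanreal f" and r: "0 \<le> r"
  shows "modulus e r f \<longleftrightarrow> modulus_seq e r (f \<circ> q)"
proof
  assume "modulus e r f"
  then show "modulus_seq e r (f \<circ> q)" using q_in unfolding modulus_def modulus_seq_def by auto
next
  assume R: "modulus_seq e r (f \<circ> q)"
  define \<epsilon> where "\<epsilon> = 1 / real (Suc (snd e))"
  show "modulus e r f"
    unfolding modulus_def \<epsilon>_def[symmetric]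
  proof (intro ballI impI, rule ccontr)
    fix x y assume x: "x \<in> K (fst e)" and y: "y \<in> M" and rd: "r * d x y < 1" and "\<not> \<bar>f x - f y\<bar> \<le> \<epsilon>"
    define \<eta> where "\<eta> = (\<bar>f x - f y\<bar> - \<epsilon>) / 2"
    have "\<eta> > 0" using \<open>\<not> _\<close> by (simp add: \<eta>_def)
    have xM: "x \<in> M" using x K_subset by blast
    obtain \<delta>1 where d1: "\<delta>1 > 0" "\<forall>z\<in>M. d x z < \<delta>1 \<longrightarrow> \<bar>f x - f z\<bar> < \<eta>"
      using continuous_map_realD[OF f xM \<open>\<eta> > 0\<close>] by blast
    obtain \<delta>2 where d2: "\<delta>2 > 0" "\<forall>z\<in>M. d y z < \<delta>2 \<longrightarrow> \<bar>f y - f z\<bar> < \<eta>"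
      using continuous_map_realD[OF f y \<open>\<eta> > 0\<close>] by blast
    \<comment> \<open>Moving both points by less than \<open>\<rho>\<close> keeps \<open>r * d x y\<close> below \<open>1\<close>.\<close>
    define \<rho> where "\<rho> = (1 - r * d x y) / (2 * (r + 1))"
    have "\<rho> > 0" using rd r by (simp add: \<rho>_def)
    obtain i where i: "q i \<in> K (fst e)" "d x (q i) < min \<delta>1 \<rho>"
      using q_dense[OF x, of "min \<delta>1 \<rho>"] d1 \<open>\<rho> > 0\<close> by auto
    obtain j where j: "d y (q j) < min \<delta>2 \<rho>"
      using dense[OF y, of "min \<delta>2 \<rho>"] d2 \<open>\<rho> > 0\<close> by auto
    have "d (q i) (q j) \<le> d (q i) x + d x (q j)" "d x (q j) \<le> d x y + d y (q j)"
      using triangle xM y q_in by auto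
    then have "d (q i) (q j) \<le> d x y + 2 * \<rho>" using i j by (simp add: commute)
    then have "r * d (q i) (q j) \<le> r * (d x y + 2 * \<rho>)" using r by (rule mult_left_mono)
    moreover have "r * (d x y + 2 * \<rho>) < 1"
    proof -
      have "2 * (r + 1) \<noteq> 0" using r by simp
      then have "\<rho> * (2 * (r + 1)) = 1 - r * d x y"
        using nonzero_eq_divide_eq[of "2 * (r + 1)" \<rho> "1 - r * d x y"] \<rho>_def by blast
      then have "r * (2 * \<rho>) = 1 - r * d x y - 2 * \<rho>" by (simp add: algebra_simps)
      then show ?thesis using \<open>\<rho> > 0\<close> by (simp add: distrib_left)
    qed
    ultimately have "\<bar>f (q i) - f (q j)\<bar> \<le> \<epsilon>"
      using R i(1) unfolding modulus_seq_def \<epsilon>_def by auto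
    moreover have "\<bar>f x - f (q i)\<bar> < \<eta>" "\<bar>f y - f (q j)\<bar> < \<eta>" using d1 d2 i j q_in by auto
    ultimately show False unfolding \<eta>_def by argo
  qed
qed

lemma modulus_mono: "modulus e r f \<Longrightarrow> r \<le> s \<Longrightarrow> modulus e s f"
  unfolding modulus_def
proof (intro ballI impI)
  fix x y
  assume *: "\<forall>x\<in>K (fst e). \<forall>y\<in>M. r * d x y < 1 \<longrightarrow> \<bar>f x - f y\<bar> \<le> 1 / real (Suc (snd e))"
    and "r \<le> s" "x \<in> K (fst e)" "y \<in> M" "s * d x y < 1"
  moreover have "r * d x y \<le> s * d x y" using \<open>r \<le> s\<close> by (intro mult_right_mono) auto
  ultimately show "\<bar>f x - f y\<bar> \<le> 1 / real (Suc (snd e))" by simp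
qed

lemma modulus_exists:
  assumes f: "continuous_map mtopology euclideanreal f"
  shows "\<exists>k::nat. modulus e (real k) f"
proof -
  have "\<exists>\<delta>>0. \<forall>x\<in>K (fst e). \<forall>y\<in>M. d x y < \<delta> \<longrightarrow> \<bar>f x - f y\<bar> \<le> 1 / real (Suc (snd e))"
    by (rule uniform_continuity_at_compact[OF K_compact f]) simp
  then obtain \<delta> where \<delta>: "\<delta> > 0"
    "\<forall>x\<in>K (fst e). \<forall>y\<in>M. d x y < \<delta> \<longrightarrow> \<bar>f x - f y\<bar> \<le> 1 / real (Suc (snd e))" by blast
  obtain k :: nat where k: "1 / \<delta> < real k" using reals_Archimedean2 by blast
  have "d x y < \<delta>" if "real k * d x y < 1" for x y
  proof (rule ccontr)
    assume "\<not> ?thesis"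
    then have "real k * \<delta> \<le> real k * d x y" by (intro mult_left_mono) auto
    moreover have "1 < real k * \<delta>" using k \<delta>(1) by (simp add: field_simps)
    ultimately show False using that by simp
  qed
  then show ?thesis unfolding modulus_def using \<delta>(2) by blast
qed

text \<open>With all admissible numbers instead of the least one, several records would belong to the same \<open>f\<close>, and the map
from records to functions would not be injective.\<close>

definition least_modulus :: "nat \<times> nat \<Rightarrow> ('a \<Rightarrow> real) \<Rightarrow> nat" where
  "least_modulus e f = (LEAST k. modulus e (real k) f)"

lemma modulus_least_modulus:
  "continuous_map mtopology euclideanreal f \<Longrightarrow> modulus e (real (least_modulus e f)) f"
  unfolding least_modulus_def using modulus_exists by (rule LeastI_ex)

lemma least_modulus_eq_iff:
  assumes f: "continuous_map mtopology euclideanreal f"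
  shows "least_modulus e f = k \<longleftrightarrow> modulus e (real k) f \<and> (k = 0 \<or> \<not> modulus e (real k - 1) f)"
proof
  assume k: "least_modulus e f = k"
  have "\<not> modulus e (real k - 1) f" if "k \<noteq> 0"
  proof -
    have "k - 1 < least_modulus e f" using that k by simp
    then have "\<not> modulus e (real (k - 1)) f" unfolding least_modulus_def by (rule not_less_Least)
    then show ?thesis using that by (simp add: of_nat_diff)
  qed
  then show "modulus e (real k) f \<and> (k = 0 \<or> \<not> modulus e (real k - 1) f)"
    using modulus_least_modulus[OF f, of e] k by auto
next
  assume R: "modulus e (real k) f \<and> (k = 0 \<or> \<not> modulus e (real k - 1) f)"
  show "least_modulus e f = k" unfolding least_modulus_def
  proof (rule Least_equality)
    fix j assume j: "modulus e (real j) f"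
    show "k \<le> j"
    proof (rule ccontr)
      assume "\<not> k \<le> j"
      then have "real j \<le> real k - 1" by simp
      then show False using R modulus_mono[OF j] \<open>\<not> k \<le> j\<close> by auto
    qed
  qed (use R in blast)
qed

definition code :: "('a \<Rightarrow> real) \<Rightarrow> nat + nat \<times> nat \<Rightarrow> real" where
  "code f = case_sum (f \<circ> q) (\<lambda>e. real (least_modulus e f))"

lemma code_simps [simp]: "code f (Inl i) = f (q i)" "code f (Inr e) = real (least_modulus e f)" "code f \<circ> Inl = f \<circ> q"
  by (auto simp: code_def)

abbreviation "CX \<equiv> C_fun mtopology"

lemma CX_cont: "f \<in> CX \<Longrightarrow> continuous_map mtopology euclideanreal f" by (simp add: C_fun_def)

lemma inj_on_code: "inj_on code CX"
proof (rule inj_onI)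
  fix f g assume fg: "f \<in> CX" "g \<in> CX" "code f = code g"
  show "f = g"
  proof
    fix x show "f x = g x"
    proof (cases "x \<in> M")
      case True
      have "x \<in> mtopology closure_of range q"
        using True dense[OF True] q_in by (auto simp: metric_closure_of)
      moreover have "f (q i) = g (q i)" for i using fun_cong[OF fg(3), of "Inl i"] by simp
      ultimately show ?thesis
        using forall_in_closure_of_eq[of x mtopology "range q" euclideanreal f g] CX_cont fg by auto
    next
      case False
      then show ?thesis using fg by (auto simp: C_fun_def extensional_def)
    qed
  qed
qed

text \<open>The range of \<open>code\<close>.  The last condition expresses minimality of the natural number \<open>g (Inr e)\<close>.\<close>

definition codes :: "(nat + nat \<times> nat \<Rightarrow> real) set" where
  "codes = {g. \<forall>e. g (Inr e) \<in> \<nat> \<and> modulus_seq e (g (Inr e)) (g \<circ> Inl) \<and>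
     (g (Inr e) < 1 \<or> \<not> modulus_seq e (g (Inr e) - 1) (g \<circ> Inl))}"

lemma code_in_codes:
  assumes f: "f \<in> CX"
  shows "code f \<in> codes"
proof -
  note c = CX_cont[OF f]
  have "code f (Inr e) \<in> \<nat> \<and> modulus_seq e (code f (Inr e)) (code f \<circ> Inl) \<and>
     (code f (Inr e) < 1 \<or> \<not> modulus_seq e (code f (Inr e) - 1) (code f \<circ> Inl))" for e
  proof -
    have least_modulus: "modulus e (real (least_modulus e f)) f" "least_modulus e f = 0 \<or> \<not> modulus e (real (least_modulus e f) - 1) f"
      using least_modulus_eq_iff[OF c, of e "least_modulus e f"] by simp_all
    have "\<not> modulus_seq e (real (least_modulus e f) - 1) (f \<circ> q)" if "least_modulus e f \<noteq> 0"
      using least_modulus(2) that modulus_iff_seq[OF c, of "real (least_modulus e f) - 1" e] by simp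
    then show ?thesis using least_modulus(1) modulus_iff_seq[OF c, of "real (least_modulus e f)" e] by auto
  qed
  then show ?thesis unfolding codes_def by blast
qed

text \<open>The moduli recorded in \<open>g\<close> bound the oscillation of the values recorded in \<open>g\<close> at every point of every
\<open>K n\<close>, that is, everywhere; so these values extend to a continuous function, whose least moduli are the recorded ones.\<close>

lemma codes_subset_image: "codes \<subseteq> code ` CX"
proof
  fix g assume g: "g \<in> codes"
  define h where "h = g \<circ> Inl"
  have "g (Inr e) \<in> \<nat> \<and> modulus_seq e (g (Inr e)) h \<and> (g (Inr e) < 1 \<or> \<not> modulus_seq e (g (Inr e) - 1) h)" for e
    using g unfolding codes_def h_def by (elim CollectE allE)
  then have ms: "modulus_seq e (g (Inr e)) h" "g (Inr e) \<in> \<nat>" "g (Inr e) < 1 \<or> \<not> modulus_seq e (g (Inr e) - 1) h" for e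
    by blast+
  have "\<exists>f. continuous_map mtopology euclideanreal f \<and> (\<forall>i. f (q i) = h i)"
  proof (rule continuous_extension_from_dense_sequence[OF q_in dense])
    fix x \<epsilon> assume x: "x \<in> M" "(0::real) < \<epsilon>"
    obtain m where m: "inverse (real (Suc m)) < \<epsilon> / 2" using x half_gt_zero reals_Archimedean by blast
    obtain n where n: "x \<in> K n" using x K_cover by blast
    define r where "r = g (Inr (n, m))"
    have r: "r \<ge> 0" using ms(2)[of "(n, m)"] by (simp add: r_def Nats_altdef2)
    have dom: "\<bar>h i - h j\<bar> \<le> 1 / real (Suc m)" if "q i \<in> K n" "r * d (q i) (q j) < 1" for i j
      using ms(1)[of "(n, m)"] that unfolding modulus_seq_def r_def by auto
    define \<delta> where "\<delta> = 1 / (2 * (r + 1))"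
    have \<delta>: "\<delta> > 0" using r by (simp add: \<delta>_def)
    have r\<delta>: "r * (2 * \<delta>) < 1" using r by (simp add: \<delta>_def field_simps)
    obtain i0 where i0: "q i0 \<in> K n" "d x (q i0) < \<delta>" using q_dense[OF n \<delta>] by blast
    have near: "\<bar>h i0 - h i\<bar> < \<epsilon> / 2" if "d x (q i) < \<delta>" for i
    proof -
      have "d (q i0) (q i) \<le> 2 * \<delta>" using triangle[of "q i0" x "q i"] q_in x i0 that by (simp add: commute)
      then have "r * d (q i0) (q i) < 1" using r\<delta> mult_left_mono[OF _ r] by fastforce
      then have "\<bar>h i0 - h i\<bar> \<le> 1 / real (Suc m)" using dom i0 by blast
      then show ?thesis using m by (simp add: inverse_eq_divide)
    qed
    have "\<bar>h i - h j\<bar> \<le> \<epsilon>" if "d x (q i) < \<delta>" "d x (q j) < \<delta>" for i j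
      using near[OF that(1)] near[OF that(2)] by linarith
    then show "\<exists>\<delta>>0. \<forall>i j. d x (q i) < \<delta> \<longrightarrow> d x (q j) < \<delta> \<longrightarrow> \<bar>h i - h j\<bar> \<le> \<epsilon>" using \<delta> by blast
  qed
  then obtain f0 where f0: "continuous_map mtopology euclideanreal f0" "\<And>i. f0 (q i) = h i" by blast
  define f where "f = restrict f0 M"
  have f: "f \<in> CX" unfolding f_def using C_fun_restrict[OF f0(1)] by simp
  have fq: "f \<circ> q = h" using f0 q_in by (auto simp: f_def)
  note c = CX_cont[OF f]
  have "real (least_modulus e f) = g (Inr e)" for e
  proof -
    obtain k where k: "g (Inr e) = real k" using ms(2)[of e] by (auto elim: Nats_cases)
    have "modulus_seq e (real k) (f \<circ> q)" using ms(1)[of e] unfolding k fq .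
    then have "modulus e (real k) f" using modulus_iff_seq[OF c, of "real k" e] by simp
    moreover have "\<not> modulus e (real k - 1) f" if "k \<noteq> 0"
    proof -
      have "\<not> modulus_seq e (real k - 1) (f \<circ> q)" using ms(3)[of e] that unfolding k fq by simp
      then show ?thesis using modulus_iff_seq[OF c, of "real k - 1" e] that by simp
    qed
    ultimately have "least_modulus e f = k" using least_modulus_eq_iff[OF c, of e k] by metis
    then show ?thesis using k by simp
  qed
  then have "code f z = g z" for z
    using fun_cong[OF fq] by (cases z) (auto simp: h_def)
  then have "code f = g" by blast
  then show "g \<in> code ` CX" using f by blast
qed

lemma image_code: "code ` CX = codes"
  using codes_subset_image code_in_codes by blast

end


section \<open>The Polish topology of recorded moduli\<close>

lemma second_countable_euclidean:
  "second_countable (euclidean :: 'b::second_countable_topology topology)"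
proof -
  obtain B :: "'b set set" where "countable B" "topological_basis B" using ex_countable_basis by blast
  then show ?thesis unfolding second_countable_def
    by (metis open_openin topological_basisE topological_basis_open)
qed

context compact_exhaustion begin

lemma continuous_on_record_coordinate [continuous_intros]: "continuous_on S (\<lambda>g :: nat + nat \<times> nat \<Rightarrow> real. g z)"
  by (rule continuous_on_subset[OF continuous_on_product_coordinates]) simp

text \<open>For each \<open>e\<close> the three conditions on \<open>g\<close> are closed, closed and open, respectively.\<close>

lemma gdelta_in_codes: "gdelta_in euclidean codes"
proof -
  define \<epsilon> where "\<epsilon> e = 1 / real (Suc (snd e))" for e :: "nat \<times> nat"
  define A where "A e = {g :: nat + nat \<times> nat \<Rightarrow> real. g (Inr e) \<in> \<nat>}" for e
  define B where "B e = (\<Inter>i\<in>{i. q i \<in> K (fst e)}. \<Inter>j. {g :: nat + nat \<times> nat \<Rightarrow> real. 1 \<le> g (Inr e) * d (q i) (q j)} \<union>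
    {g. \<bar>g (Inl i) - g (Inl j)\<bar> \<le> \<epsilon> e})" for e
  define C where "C e = {g :: nat + nat \<times> nat \<Rightarrow> real. g (Inr e) < 1} \<union>
    (\<Union>i\<in>{i. q i \<in> K (fst e)}. \<Union>j. {g. (g (Inr e) - 1) * d (q i) (q j) < 1} \<inter>
    {g. \<epsilon> e < \<bar>g (Inl i) - g (Inl j)\<bar>})" for e
  have A: "closed (A e)" for e
  proof -
    have "closed ((\<lambda>g :: nat + nat \<times> nat \<Rightarrow> real. g (Inr e)) -` \<nat>)"
      by (intro closed_vimage closed_Nats continuous_intros)
    then show ?thesis by (simp add: A_def vimage_def)
  qed
  have B: "closed (B e)" for e
    unfolding B_def by (intro closed_INT ballI closed_Un closed_Collect_le continuous_intros)
  have C: "open (C e)" for e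
    unfolding C_def by (intro open_UN ballI open_Un open_Int open_Collect_less continuous_intros)
  have modB: "modulus_seq e (g (Inr e)) (g \<circ> Inl) \<longleftrightarrow> g \<in> B e" for e g
    unfolding modulus_seq_def B_def \<epsilon>_def[symmetric]
    by (auto simp: linorder_not_less[symmetric])
  have modC: "(g (Inr e) < 1 \<or> \<not> modulus_seq e (g (Inr e) - 1) (g \<circ> Inl)) \<longleftrightarrow> g \<in> C e" for e g
    unfolding modulus_seq_def C_def \<epsilon>_def[symmetric] by (auto simp: not_le)
  have "codes = (\<Inter>e. A e \<inter> B e \<inter> C e)"
    unfolding codes_def modB modC by (auto simp only: A_def)
  moreover have "gdelta_in euclidean (A e \<inter> B e \<inter> C e)" for e
    using A B C by (intro gdelta_in_Int closed_imp_gdelta_in open_imp_gdelta_in metrizable_space_euclidean) simp_all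
  ultimately show ?thesis by (auto intro!: gdelta_in_Inter)
qed

definition code_topology :: "('a \<Rightarrow> real) topology" where
  "code_topology = pullback_topology CX code euclidean"

lemma topspace_code_topology [simp]: "topspace code_topology = CX"
  by (simp add: code_topology_def topspace_pullback_topology)

lemma openin_code_topology: "openin code_topology U \<longleftrightarrow> (\<exists>V. open V \<and> U = {f \<in> CX. code f \<in> V})"
  unfolding code_topology_def openin_pullback_topology by (auto simp: vimage_def Collect_conj_eq Int_commute)

lemma Polish_code_topology: "Polish_space code_topology"
proof -
  have "homeomorphic_map code_topology (subtopology euclidean codes) code"
  proof (rule bijective_open_imp_homeomorphic_map)
    show "continuous_map code_topology (subtopology euclidean codes) code"
      unfolding continuous_map_in_subtopology
    proof
      show "continuous_map code_topology euclidean code"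
        unfolding continuous_map_def openin_code_topology by auto
    qed (simp add: image_code[symmetric])
    show "open_map code_topology (subtopology euclidean codes) code"
      unfolding open_map_def
    proof (intro allI impI)
      fix U assume "openin code_topology U"
      then obtain V where V: "open V" "U = {f \<in> CX. code f \<in> V}" unfolding openin_code_topology by blast
      then have "code ` U = codes \<inter> V" unfolding image_code[symmetric] by auto
      then show "openin (subtopology euclidean codes) (code ` U)" using V by (simp add: openin_open_Int)
    qed
  qed (use image_code inj_on_code in simp_all)
  then have hom: "code_topology homeomorphic_space subtopology euclidean codes"
    by (rule homeomorphic_map_imp_homeomorphic_space)
  have "completely_metrizable_space (subtopology euclidean codes)"
    by (intro completely_metrizable_space_gdelta_in completely_metrizable_space_euclidean gdelta_in_codes)
  moreover have "separable_space (subtopology euclidean codes)"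
    by (intro second_countable_imp_separable_space second_countable_subtopology second_countable_euclidean)
  ultimately show ?thesis unfolding Polish_space_def
    using homeomorphic_completely_metrizable_space[OF hom] homeomorphic_separable_space[OF hom] by blast
qed

text \<open>Cover \<open>L\<close> by finitely many balls on which the recorded moduli of \<open>f\<close> limit the variation to \<open>\<eta>\<close>.  A function with
the same finitely many moduli has the same bound on its variation there, so closeness at one point \<open>q (i x)\<close> of each ball is
closeness on \<open>L\<close>, at the price of the five terms in the triangle inequality.\<close>

lemma code_topology_compact_open:
  assumes f: "f \<in> CX" and L: "compactin mtopology L" and \<epsilon>: "\<epsilon> > 0"
  shows "\<exists>W. openin code_topology W \<and> f \<in> W \<and> (\<forall>g\<in>W. \<forall>x\<in>L. \<bar>g x - f x\<bar> < \<epsilon>)"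
proof -
  have LM: "L \<subseteq> M" using compactin_subset_topspace[OF L] by simp
  note c = CX_cont[OF f]
  obtain m where m: "inverse (real (Suc m)) < \<epsilon> / 5" using \<epsilon> reals_Archimedean[of "\<epsilon> / 5"] by auto
  define \<eta> where "\<eta> = 1 / real (Suc m)"
  have \<eta>: "\<eta> > 0" "5 * \<eta> < \<epsilon>" using m by (auto simp: \<eta>_def inverse_eq_divide)
  have "\<forall>x\<in>L. \<exists>n. x \<in> K n" using LM K_cover by blast
  then obtain n where n: "\<And>x. x \<in> L \<Longrightarrow> x \<in> K (n x)" by metis
  define k where "k x = least_modulus (n x, m) f" for x
  define r where "r x = 1 / (real (k x) + 1)" for x
  have r: "r x > 0" for x by (simp add: r_def)
  have kr: "real (k x) * t < 1" if "t < r x" for x t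
  proof -
    have "t * (real (k x) + 1) < 1" using that by (simp add: r_def field_simps)
    moreover have "real (k x) * t \<le> 0" if "t < 0" using that by (simp add: mult_nonneg_nonpos)
    ultimately show ?thesis by (cases "t < 0") (auto simp: algebra_simps)
  qed
  have "\<forall>x\<in>L. \<exists>i. d x (q i) < r x" using dense LM r by blast
  then obtain i where i: "\<And>x. x \<in> L \<Longrightarrow> d x (q (i x)) < r x" by metis
  have "\<exists>\<F>. finite \<F> \<and> \<F> \<subseteq> (\<lambda>x. mball x (r x)) ` L \<and> L \<subseteq> \<Union>\<F>"
  proof (rule compactinD[OF L])
    show "L \<subseteq> \<Union> ((\<lambda>x. mball x (r x)) ` L)"
    proof
      fix x assume "x \<in> L"
      then have "x \<in> mball x (r x)" using LM r[of x] by auto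
      then show "x \<in> \<Union> ((\<lambda>x. mball x (r x)) ` L)" using \<open>x \<in> L\<close> by blast
    qed
  qed auto
  then obtain \<F> where \<F>: "finite \<F>" "\<F> \<subseteq> (\<lambda>x. mball x (r x)) ` L" "L \<subseteq> \<Union>\<F>" by blast
  obtain F where "F \<subseteq> L" "finite F" "\<F> = (\<lambda>x. mball x (r x)) ` F"
    using finite_subset_image[OF \<F>(1,2)] by blast
  then have F: "finite F" "F \<subseteq> L" "L \<subseteq> (\<Union>x\<in>F. mball x (r x))" using \<F>(3) by auto
  define V where "V = (\<Inter>x\<in>F. {z :: nat + nat \<times> nat \<Rightarrow> real. \<bar>z (Inr (n x, m)) - real (k x)\<bar> < 1} \<inter>
    {z. \<bar>z (Inl (i x)) - f (q (i x))\<bar> < \<eta>})"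
  have "open V" unfolding V_def using F(1)
    by (intro open_INT ballI open_Int open_Collect_less continuous_intros)
  define W where "W = {g \<in> CX. code g \<in> V}"
  have "openin code_topology W" unfolding W_def openin_code_topology using \<open>open V\<close> by blast
  moreover have "f \<in> W" using f \<eta> by (auto simp: W_def V_def k_def)
  moreover have "\<bar>g y - f y\<bar> < \<epsilon>" if g: "g \<in> W" and y: "y \<in> L" for g y
  proof -
    obtain x where x: "x \<in> F" "y \<in> mball x (r x)" using F y by blast
    have xL: "x \<in> L" using x F by blast
    have gc: "continuous_map mtopology euclideanreal g" using g CX_cont by (auto simp: W_def)
    have least_modulus: "least_modulus (n x, m) g = k x" using g x(1) by (auto simp: W_def V_def)
    have gq: "\<bar>g (q (i x)) - f (q (i x))\<bar> < \<eta>" using g x(1) by (auto simp: W_def V_def)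
    have osc: "\<bar>h x - h z\<bar> \<le> \<eta>" if "modulus (n x, m) (real (k x)) h" "z \<in> M" "d x z < r x" for h z
      using that n[OF xL] kr unfolding modulus_def \<eta>_def by auto
    have mg: "modulus (n x, m) (real (k x)) g" using modulus_least_modulus[OF gc, of "(n x, m)"] least_modulus by simp
    have mf: "modulus (n x, m) (real (k x)) f" using modulus_least_modulus[OF c, of "(n x, m)"] by (simp add: k_def)
    have "\<bar>g x - g y\<bar> \<le> \<eta>" "\<bar>f x - f y\<bar> \<le> \<eta>" "\<bar>g x - g (q (i x))\<bar> \<le> \<eta>" "\<bar>f x - f (q (i x))\<bar> \<le> \<eta>"
      using osc[OF mg] osc[OF mf] x(2) i[OF xL] q_in by auto
    then show ?thesis using gq \<eta>(2) by linarith
  qed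
  ultimately show ?thesis by blast
qed

text \<open>The hypotheses on \<open>\<Gamma>\<close> are what \<open>F\<^sub>\<sigma>\<close> and \<open>C\<^sub>\<delta>\<^sub>\<sigma>\<close> sets have in common.  The sets \<open>modulus e r\<close> are of the form
\<open>near\<close>, their complements are countable unions of sets of the form \<open>far\<close>, and \<open>least_modulus e f = k\<close> is an intersection of the two kinds.\<close>

lemma code_topology_open_in_class:
  fixes \<Gamma> :: "('a \<Rightarrow> real) set \<Rightarrow> bool"
  assumes whole: "\<Gamma> CX" and Int: "\<And>A B. \<Gamma> A \<Longrightarrow> \<Gamma> B \<Longrightarrow> \<Gamma> (A \<inter> B)"
    and Un: "\<And>\<A>. countable \<A> \<Longrightarrow> (\<And>A. A \<in> \<A> \<Longrightarrow> \<Gamma> A) \<Longrightarrow> \<Gamma> (\<Union>\<A>)"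
    and eval: "\<And>x V. x \<in> M \<Longrightarrow> open V \<Longrightarrow> \<Gamma> {f \<in> CX. f x \<in> V}"
    and far: "\<And>x y \<epsilon>. x \<in> M \<Longrightarrow> y \<in> M \<Longrightarrow> \<Gamma> {f \<in> CX. \<epsilon> < \<bar>f x - f y\<bar>}"
    and near: "\<And>I \<epsilon>. countable I \<Longrightarrow> I \<subseteq> M \<times> M \<Longrightarrow> \<Gamma> {f \<in> CX. \<forall>(x, y)\<in>I. \<bar>f x - f y\<bar> \<le> \<epsilon>}"
    and U: "openin code_topology U"
  shows "\<Gamma> U"
proof -
  have empty: "\<Gamma> {}" using Un[of "{}"] by simp
  have UN: "\<Gamma> (\<Union>i\<in>I. A i)" if "countable I" "\<And>i. i \<in> I \<Longrightarrow> \<Gamma> (A i)" for I :: "'i set" and A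
    using that by (intro Un) auto
  have Un2: "\<Gamma> (A \<union> B)" if "\<Gamma> A" "\<Gamma> B" for A B using Un[of "{A, B}"] that by auto
  define pairs where "pairs e r = {(x, y). x \<in> range q \<and> y \<in> range q \<and> x \<in> K (fst e) \<and> r * d x y < 1}"
    for e :: "nat \<times> nat" and r
  have pairs: "countable (pairs e r)" "pairs e r \<subseteq> M \<times> M" for e r
  proof -
    have "pairs e r \<subseteq> range q \<times> range q" by (auto simp: pairs_def)
    then show "countable (pairs e r)" by (rule countable_subset) simp
    show "pairs e r \<subseteq> M \<times> M" using q_in by (auto simp: pairs_def)
  qed
  have mod_iff: "modulus e r f \<longleftrightarrow> (\<forall>(x, y)\<in>pairs e r. \<bar>f x - f y\<bar> \<le> 1 / real (Suc (snd e)))"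
    if "f \<in> CX" "r \<ge> 0" for e r f
    unfolding modulus_iff_seq[OF CX_cont[OF that(1)] that(2)] modulus_seq_def pairs_def by auto
  have mod: "\<Gamma> {f \<in> CX. modulus e r f}" if "r \<ge> 0" for e r
  proof -
    have "{f \<in> CX. modulus e r f} = {f \<in> CX. \<forall>(x, y)\<in>pairs e r. \<bar>f x - f y\<bar> \<le> 1 / real (Suc (snd e))}"
      using mod_iff that by blast
    then show ?thesis using near[OF pairs] by simp
  qed
  have nmod: "\<Gamma> {f \<in> CX. \<not> modulus e r f}" if "r \<ge> 0" for e r
  proof -
    have "{f \<in> CX. \<not> modulus e r f} = (\<Union>p\<in>pairs e r. {f \<in> CX. 1 / real (Suc (snd e)) < \<bar>f (fst p) - f (snd p)\<bar>})"
      using mod_iff[OF _ that] by fastforce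
    moreover have "\<Gamma> (\<Union>p\<in>pairs e r. {f \<in> CX. 1 / real (Suc (snd e)) < \<bar>f (fst p) - f (snd p)\<bar>})"
    proof (rule UN[OF pairs(1)])
      fix p assume "p \<in> pairs e r"
      then have "p \<in> M \<times> M" using pairs(2) by blast
      then show "\<Gamma> {f \<in> CX. 1 / real (Suc (snd e)) < \<bar>f (fst p) - f (snd p)\<bar>}"
        by (intro far) auto
    qed
    ultimately show ?thesis by simp
  qed
  have least_modulus: "\<Gamma> {f \<in> CX. least_modulus e f = k}" for e k
  proof (cases "k = 0")
    case True
    have "{f \<in> CX. least_modulus e f = k} = {f \<in> CX. modulus e (real k) f}"
      using least_modulus_eq_iff[OF CX_cont, of _ e k] True by auto
    then show ?thesis using mod by simp
  next
    case False
    have "{f \<in> CX. least_modulus e f = k} = {f \<in> CX. modulus e (real k) f} \<inter> {f \<in> CX. \<not> modulus e (real k - 1) f}"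
      using least_modulus_eq_iff[OF CX_cont, of _ e k] False by auto
    then show ?thesis using Int mod nmod False by simp
  qed
  have coord: "\<Gamma> {f \<in> CX. code f z \<in> V}" if V: "open V" for z V
  proof (cases z)
    case (Inl i)
    then show ?thesis using eval[OF q_in V] by simp
  next
    case (Inr e)
    have "{f \<in> CX. code f z \<in> V} = (\<Union>k\<in>{k. real k \<in> V}. {f \<in> CX. least_modulus e f = k})" using Inr by auto
    moreover have "\<Gamma> (\<Union>k\<in>{k. real k \<in> V}. {f \<in> CX. least_modulus e f = k})"
      by (rule UN[OF countableI_type least_modulus])
    ultimately show ?thesis by simp
  qed
  obtain B :: "(nat + nat \<times> nat \<Rightarrow> real) set set" where B: "topological_basis B" "countable B"
    "\<forall>k\<in>B. \<exists>X. k = Pi\<^sub>E UNIV X \<and> (\<forall>i. open (X i)) \<and> finite {i. X i \<noteq> UNIV}"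
    using product_topology_countable_basis by blast
  have basis: "\<Gamma> {f \<in> CX. code f \<in> b}" if b: "b \<in> B" for b
  proof -
    obtain X where X: "b = Pi\<^sub>E UNIV X" "\<forall>i. open (X i)" "finite {i. X i \<noteq> UNIV}" using bspec[OF B(3) b] by blast
    have fin: "\<Gamma> {f \<in> CX. \<forall>i\<in>F. code f i \<in> X i}" if "finite F" for F
      using that
    proof (induction F)
      case empty
      then show ?case using whole by simp
    next
      case (insert z F)
      have "{f \<in> CX. \<forall>i\<in>insert z F. code f i \<in> X i} = {f \<in> CX. code f z \<in> X z} \<inter> {f \<in> CX. \<forall>i\<in>F. code f i \<in> X i}"
        by blast
      then show ?case using Int coord X(2) insert by simp
    qed
    have "{f \<in> CX. code f \<in> b} = {f \<in> CX. \<forall>i\<in>{i. X i \<noteq> UNIV}. code f i \<in> X i}"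
      unfolding X(1) PiE_UNIV_domain by blast
    then show ?thesis using fin[OF X(3)] by (simp only:)
  qed
  obtain V where V: "open V" "U = {f \<in> CX. code f \<in> V}" using U unfolding openin_code_topology by blast
  have "\<exists>B'\<subseteq>B. \<Union>B' = V" using B(1) V(1) by (simp add: topological_basis_def)
  then obtain B' where B': "B' \<subseteq> B" "\<Union>B' = V" by (elim exE conjE)
  have "U = (\<Union>b\<in>B'. {f \<in> CX. code f \<in> b})" unfolding V(2) B'(2)[symmetric] by auto
  moreover have "\<Gamma> (\<Union>b\<in>B'. {f \<in> CX. code f \<in> b})"
  proof (rule UN)
    show "countable B'" using countable_subset B'(1) B(2) by blast
    show "\<Gamma> {f \<in> CX. code f \<in> b}" if "b \<in> B'" for b using basis B'(1) that by blast
  qed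
  ultimately show ?thesis by simp
qed

end


section \<open>Descriptive complexity of the open sets\<close>

text \<open>Finite \<open>1/(m+1)\<close>-nets inside the compact sets provide the dense sequence.\<close>

lemma sigma_compact_metrizable_imp_exhaustion:
  assumes X: "metrizable_space X" "sigma_compact_space X" and ne: "topspace X \<noteq> {}"
  shows "\<exists>M d K q. compact_exhaustion M d K q \<and> X = Metric_space.mtopology M d"
proof -
  obtain M d where MS: "Metric_space M d" and Xeq: "X = Metric_space.mtopology M d"
    using X unfolding metrizable_space_def by blast
  interpret Metric_space M d by (rule MS)
  obtain \<U> where U: "countable \<U>" "\<U> \<subseteq> Collect (compactin X)" "\<Union>\<U> = M"
    using X(2) unfolding sigma_compact_space_def union_of_def Xeq by auto
  have "\<U> \<noteq> {}" using U(3) ne Xeq by auto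
  define K where "K = from_nat_into \<U>"
  have rK: "range K = \<U>" unfolding K_def using \<open>\<U> \<noteq> {}\<close> U(1) by (rule range_from_nat_into)
  have K: "compactin mtopology (K n)" for n using rK U(2) Xeq by auto
  have cover: "(\<Union>n. K n) = M" using rK U(3) by simp
  have "\<forall>n m. \<exists>F. finite F \<and> F \<subseteq> K n \<and> K n \<subseteq> (\<Union>x\<in>F. mball x (1 / real (Suc m)))"
  proof (intro allI)
    fix n m
    have "0 < 1 / real (Suc m)" by simp
    then show "\<exists>F. finite F \<and> F \<subseteq> K n \<and> K n \<subseteq> (\<Union>x\<in>F. mball x (1 / real (Suc m)))"
      using compactin_imp_mtotally_bounded[OF K[of n]] unfolding mtotally_bounded_def by blast
  qed
  then obtain F where F: "\<And>n m. finite (F n m)" "\<And>n m. F n m \<subseteq> K n"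
    "\<And>n m. K n \<subseteq> (\<Union>x\<in>F n m. mball x (1 / real (Suc m)))" by metis
  define D where "D = (\<Union>n m. F n m)"
  have "countable D" unfolding D_def using F(1) by (intro countable_UN) (auto intro: countable_finite)
  have DM: "D \<subseteq> M" unfolding D_def using F(2) cover by blast
  have densD: "\<exists>y\<in>D. y \<in> K n \<and> d x y < r" if x: "x \<in> K n" and r: "0 < r" for n x r
  proof -
    obtain m where m: "inverse (real (Suc m)) < r" using r reals_Archimedean by blast
    obtain y where y: "y \<in> F n m" "x \<in> mball y (1 / real (Suc m))" using F(3) x by blast
    then have "d x y < 1 / real (Suc m)" by (simp add: commute)
    then have "d x y < r" using m by (simp add: inverse_eq_divide)
    moreover have "y \<in> K n" "y \<in> D" using y F(2) by (auto simp: D_def)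
    ultimately show ?thesis by blast
  qed
  have "D \<noteq> {}"
  proof -
    obtain x where "x \<in> M" using ne Xeq by auto
    then obtain n where "x \<in> K n" using cover by blast
    then show ?thesis using densD[of x n 1] by auto
  qed
  define q where "q = from_nat_into D"
  have rq: "range q = D" unfolding q_def using \<open>D \<noteq> {}\<close> \<open>countable D\<close> by (rule range_from_nat_into)
  have "compact_exhaustion M d K q"
  proof
    show "compactin mtopology (K n)" for n by (rule K)
    show "(\<Union>n. K n) = M" by (rule cover)
    show "q i \<in> M" for i using rq DM by blast
    show "\<exists>i. q i \<in> K n \<and> d x (q i) < r" if x: "x \<in> K n" and r: "0 < r" for n x r
    proof -
      obtain y where y: "y \<in> D" "y \<in> K n" "d x y < r" using densD[OF x r] by blast
      then obtain i where "q i = y" using rq by blast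
      then show ?thesis using y by blast
    qed
  qed
  then show ?thesis using Xeq by blast
qed

lemma fsigma_in_preimage_open:
  assumes "continuous_map T euclideanreal \<phi>" "open V"
  shows "fsigma_in T {f \<in> topspace T. \<phi> f \<in> V}"
proof -
  have "fsigma_in euclideanreal V"
    using assms(2) by (intro open_imp_fsigma_in metrizable_space_euclidean) simp
  then obtain C :: "nat \<Rightarrow> real set" where C: "\<forall>n. closedin euclideanreal (C n)" "(\<Union>n. C n) = V"
    unfolding fsigma_in_ascending by blast
  have "{f \<in> topspace T. \<phi> f \<in> V} = (\<Union>n. {f \<in> topspace T. \<phi> f \<in> C n})" using C(2) by blast
  moreover have "fsigma_in T (\<Union>n. {f \<in> topspace T. \<phi> f \<in> C n})"
  proof (rule fsigma_in_Union)
    fix S assume "S \<in> range (\<lambda>n. {f \<in> topspace T. \<phi> f \<in> C n})"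
    then show "fsigma_in T S"
      using closedin_continuous_map_preimage[OF assms(1)] C(1) by (auto intro: closed_imp_fsigma_in)
  qed simp
  ultimately show ?thesis by simp
qed

lemma (in compact_exhaustion) code_topology_open_fsigma:
  assumes T: "topspace T = CX" and ev: "\<And>x. x \<in> M \<Longrightarrow> continuous_map T euclideanreal (\<lambda>f. f x)"
    and U: "openin code_topology U"
  shows "fsigma_in T U"
proof (rule code_topology_open_in_class[OF _ _ _ _ _ _ U])
  show "fsigma_in T CX" using fsigma_in_topspace[of T] T by simp
  show "fsigma_in T (A \<inter> B)" if "fsigma_in T A" "fsigma_in T B" for A B using that by (rule fsigma_in_Int)
  show "fsigma_in T (\<Union>\<A>)" if "countable \<A>" "\<And>A. A \<in> \<A> \<Longrightarrow> fsigma_in T A" for \<A>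
    using that by (rule fsigma_in_Union)
  show "fsigma_in T {f \<in> CX. f x \<in> V}" if "x \<in> M" "open V" for x V
    using fsigma_in_preimage_open[OF ev that(2)] that T by simp
  have diff: "continuous_map T euclideanreal (\<lambda>f. \<bar>f x - f y\<bar>)" if "x \<in> M" "y \<in> M" for x y
    using ev that by (intro continuous_intros) auto
  show "fsigma_in T {f \<in> CX. \<epsilon> < \<bar>f x - f y\<bar>}" if "x \<in> M" "y \<in> M" for x y \<epsilon>
    using fsigma_in_preimage_open[OF diff[OF that] open_greaterThan[of \<epsilon>]] T by simp
  show "fsigma_in T {f \<in> CX. \<forall>(x, y)\<in>I. \<bar>f x - f y\<bar> \<le> \<epsilon>}" if I: "countable I" "I \<subseteq> M \<times> M" for I \<epsilon>
  proof (rule closed_imp_fsigma_in)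
    have "closedin T (topspace T \<inter> {f \<in> topspace T. \<bar>f x - f y\<bar> \<in> {..\<epsilon>}})" if "(x, y) \<in> I" for x y
      using that I by (intro closedin_Int closedin_topspace closedin_continuous_map_preimage[OF diff]) auto
    then have "closedin T (\<Inter>(insert (topspace T) ((\<lambda>(x, y). topspace T \<inter> {f \<in> topspace T. \<bar>f x - f y\<bar> \<in> {..\<epsilon>}}) ` I)))"
      by (intro closedin_Inter) auto
    moreover have "\<Inter>(insert (topspace T) ((\<lambda>(x, y). topspace T \<inter> {f \<in> topspace T. \<bar>f x - f y\<bar> \<in> {..\<epsilon>}}) ` I))
      = {f \<in> CX. \<forall>(x, y)\<in>I. \<bar>f x - f y\<bar> \<le> \<epsilon>}" unfolding T by fastforce
    ultimately show "closedin T {f \<in> CX. \<forall>(x, y)\<in>I. \<bar>f x - f y\<bar> \<le> \<epsilon>}" by simp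
  qed
qed

lemma constructible_in_open: "openin T U \<Longrightarrow> constructible_in T U"
  unfolding constructible_in_def by blast

lemma constructible_in_Int: "constructible_in T A \<Longrightarrow> constructible_in T B \<Longrightarrow> constructible_in T (A \<inter> B)"
  unfolding constructible_in_def by (auto simp: algebra_iff_Int)

lemma constructible_in_compl: "constructible_in T A \<Longrightarrow> constructible_in T (topspace T - A)"
  unfolding constructible_in_def using algebra.compl_sets by blast

lemma constructible_in_imp_subset: "constructible_in T A \<Longrightarrow> A \<subseteq> topspace T"
proof -
  assume A: "constructible_in T A"
  have "algebra (topspace T) (Pow (topspace T))" by (auto simp: algebra_iff_Un)
  moreover have "Collect (openin T) \<subseteq> Pow (topspace T)" using openin_subset by blast
  ultimately show ?thesis using A unfolding constructible_in_def by blast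
qed

lemma cdelta_in_INT:
  assumes "countable I" "\<And>i. i \<in> I \<Longrightarrow> constructible_in T (A i)"
  shows "cdelta_in T (topspace T \<inter> (\<Inter>i\<in>I. A i))"
  unfolding cdelta_in_def
  by (rule relative_to_inc) (use assms in \<open>auto simp: intersection_of_def intro!: exI[of _ "A ` I"]\<close>)

lemma cdelta_in_Int: "cdelta_in T A \<Longrightarrow> cdelta_in T B \<Longrightarrow> cdelta_in T (A \<inter> B)"
  unfolding cdelta_in_def by (rule relative_to_Int) (auto intro: countable_intersection_of_inter)

lemma cdelta_imp_cdelta_sigma: "cdelta_in T A \<Longrightarrow> cdelta_sigma_in T A"
  unfolding cdelta_sigma_in_def by (rule countable_union_of_inc)

lemma constructible_imp_cdelta_sigma:
  assumes "constructible_in T A"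
  shows "cdelta_sigma_in T A"
proof -
  have "cdelta_in T (topspace T \<inter> (\<Inter>i\<in>{()}. A))" using assms by (intro cdelta_in_INT) auto
  then show ?thesis
    using constructible_in_imp_subset[OF assms] by (auto intro: cdelta_imp_cdelta_sigma simp: Int_absorb1)
qed

lemma cdelta_sigma_in_UN:
  "countable I \<Longrightarrow> (\<And>i. i \<in> I \<Longrightarrow> cdelta_sigma_in T (A i)) \<Longrightarrow> cdelta_sigma_in T (\<Union>i\<in>I. A i)"
  unfolding cdelta_sigma_in_def by (rule countable_union_of_UN)

text \<open>Sets \<open>a \<le> f x < b\<close> are differences of two open sets.  A strict inequality \<open>\<epsilon> < f x - f y\<close> is witnessed by a
rational \<open>s\<close> with \<open>f y < s\<close> and \<open>s + \<epsilon> \<le> f x\<close>; so sets \<open>far\<close> are countable unions of constructible sets \<open>G x y s \<epsilon>\<close>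
and sets \<open>near\<close> are countable intersections of their complements.\<close>

lemma (in compact_exhaustion) code_topology_open_cdelta_sigma:
  assumes T: "topspace T = CX" and open_less: "\<And>x r. x \<in> M \<Longrightarrow> openin T {f \<in> CX. f x < r}"
    and U: "openin code_topology U"
  shows "cdelta_sigma_in T U"
proof -
  have less: "constructible_in T {f \<in> CX. f x < r}" if "x \<in> M" for x r
    using open_less[OF that] by (rule constructible_in_open)
  define G where "G x y s \<epsilon> = {f \<in> CX. f y < s} \<inter> (CX - {f \<in> CX. f x < s + \<epsilon>})" for x y s \<epsilon>
  have G: "constructible_in T (G x y s \<epsilon>)" "constructible_in T (CX - G x y s \<epsilon>)" if "x \<in> M" "y \<in> M" for x y s \<epsilon>
  proof -
    show *: "constructible_in T (G x y s \<epsilon>)" unfolding G_def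
      using constructible_in_Int[OF less[OF that(2)] constructible_in_compl[OF less[OF that(1)]]] T by simp
    show "constructible_in T (CX - G x y s \<epsilon>)" using constructible_in_compl[OF *] T by simp
  qed
  have G_iff: "(\<exists>s\<in>\<rat>. f \<in> G x y s \<epsilon>) \<longleftrightarrow> \<epsilon> < f x - f y" if "f \<in> CX" for f x y \<epsilon>
  proof
    assume "\<exists>s\<in>\<rat>. f \<in> G x y s \<epsilon>"
    then obtain s where "f y < s" "\<not> f x < s + \<epsilon>" unfolding G_def using that by blast
    then show "\<epsilon> < f x - f y" by linarith
  next
    assume "\<epsilon> < f x - f y"
    then have "f y < f x - \<epsilon>" by linarith
    then obtain s where "s \<in> \<rat>" "f y < s" "s < f x - \<epsilon>" using Rats_dense_in_real by blast
    then show "\<exists>s\<in>\<rat>. f \<in> G x y s \<epsilon>" unfolding G_def using that by (intro bexI[of _ s]) auto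
  qed
  have far_iff: "\<epsilon> < \<bar>f x - f y\<bar> \<longleftrightarrow> (\<exists>s\<in>\<rat>. f \<in> G x y s \<epsilon> \<or> f \<in> G y x s \<epsilon>)" if "f \<in> CX" for f x y \<epsilon>
  proof -
    have "\<epsilon> < \<bar>f x - f y\<bar> \<longleftrightarrow> \<epsilon> < f x - f y \<or> \<epsilon> < f y - f x" by linarith
    then show ?thesis using G_iff[OF that, of x y \<epsilon>] G_iff[OF that, of y x \<epsilon>] by blast
  qed
  have near_iff: "\<bar>f x - f y\<bar> \<le> \<epsilon> \<longleftrightarrow> \<not> (\<exists>s\<in>\<rat>. f \<in> G x y s \<epsilon> \<or> f \<in> G y x s \<epsilon>)" if "f \<in> CX" for f x y \<epsilon>
    unfolding far_iff[OF that, symmetric] by (simp add: not_less)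
  show ?thesis
  proof (rule code_topology_open_in_class[OF _ _ _ _ _ _ U])
    show "cdelta_sigma_in T CX"
      using constructible_imp_cdelta_sigma[OF constructible_in_open[OF openin_topspace[of T]]] T by simp
    show "cdelta_sigma_in T (A \<inter> B)" if "cdelta_sigma_in T A" "cdelta_sigma_in T B" for A B
      using that unfolding cdelta_sigma_in_def by (rule countable_union_of_Int) (auto intro: cdelta_in_Int)
    show "cdelta_sigma_in T (\<Union>\<A>)" if "countable \<A>" "\<And>A. A \<in> \<A> \<Longrightarrow> cdelta_sigma_in T A" for \<A>
      using that unfolding cdelta_sigma_in_def by (rule countable_union_of_Union)
    show "cdelta_sigma_in T {f \<in> CX. f x \<in> V}" if x: "x \<in> M" and V: "open V" for x V
    proof -
      define I where "I = {(a, b). a \<in> \<rat> \<and> b \<in> \<rat> \<and> {a..<b} \<subseteq> V}"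
      have cI: "countable I"
        by (rule countable_subset[of _ "\<rat> \<times> \<rat>"]) (auto simp: I_def countable_rat)
      have "{f \<in> CX. f x \<in> V} = (\<Union>(a, b)\<in>I. {f \<in> CX. f x < b} \<inter> (CX - {f \<in> CX. f x < a}))"
      proof (intro equalityI subsetI)
        fix f assume "f \<in> {f \<in> CX. f x \<in> V}"
        then have f: "f \<in> CX" "f x \<in> V" by auto
        then obtain e where e: "e > 0" "ball (f x) e \<subseteq> V" using V openE by blast
        obtain a where a: "a \<in> \<rat>" "f x - e < a" "a < f x" using Rats_dense_in_real[of "f x - e" "f x"] e by auto
        obtain b where b: "b \<in> \<rat>" "f x < b" "b < f x + e" using Rats_dense_in_real[of "f x" "f x + e"] e by auto
        have "{a..<b} \<subseteq> V" using a b e(2) by (auto simp: dist_real_def subset_iff)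
        then have "(a, b) \<in> I" using a b by (simp add: I_def)
        moreover have "f \<in> {f \<in> CX. f x < b} \<inter> (CX - {f \<in> CX. f x < a})" using f a b by auto
        ultimately show "f \<in> (\<Union>(a, b)\<in>I. {f \<in> CX. f x < b} \<inter> (CX - {f \<in> CX. f x < a}))" by blast
      next
        fix f assume "f \<in> (\<Union>(a, b)\<in>I. {f \<in> CX. f x < b} \<inter> (CX - {f \<in> CX. f x < a}))"
        then obtain a b where "(a, b) \<in> I" "f \<in> CX" "f x < b" "\<not> f x < a" by blast
        then show "f \<in> {f \<in> CX. f x \<in> V}" by (auto simp: I_def)
      qed
      moreover have "cdelta_sigma_in T (\<Union>(a, b)\<in>I. {f \<in> CX. f x < b} \<inter> (CX - {f \<in> CX. f x < a}))"
      proof (rule cdelta_sigma_in_UN[OF cI], clarify)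
        fix a b
        show "cdelta_sigma_in T ({f \<in> CX. f x < b} \<inter> (CX - {f \<in> CX. f x < a}))"
          using constructible_in_Int[OF less[OF x] constructible_in_compl[OF less[OF x]]] T
          by (simp add: constructible_imp_cdelta_sigma)
      qed
      ultimately show ?thesis by simp
    qed
    show "cdelta_sigma_in T {f \<in> CX. \<epsilon> < \<bar>f x - f y\<bar>}" if xy: "x \<in> M" "y \<in> M" for x y \<epsilon>
    proof -
      have "{f \<in> CX. \<epsilon> < \<bar>f x - f y\<bar>} = (\<Union>(u, v)\<in>{(x, y), (y, x)}. \<Union>s\<in>\<rat>. G u v s \<epsilon>)"
        using far_iff[of _ \<epsilon> x y] by (auto simp: G_def)
      moreover have "cdelta_sigma_in T (\<Union>(u, v)\<in>{(x, y), (y, x)}. \<Union>s\<in>\<rat>. G u v s \<epsilon>)"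
      proof (rule cdelta_sigma_in_UN)
        have "cdelta_sigma_in T (\<Union>s\<in>\<rat>. G u v s \<epsilon>)" if "u \<in> M" "v \<in> M" for u v
          by (rule cdelta_sigma_in_UN[OF countable_rat constructible_imp_cdelta_sigma[OF G(1)[OF that]]])
        then show "cdelta_sigma_in T (case p of (u, v) \<Rightarrow> \<Union>s\<in>\<rat>. G u v s \<epsilon>)" if "p \<in> {(x, y), (y, x)}" for p
          using that xy by auto
      qed simp
      ultimately show ?thesis by simp
    qed
    show "cdelta_sigma_in T {f \<in> CX. \<forall>(x, y)\<in>I. \<bar>f x - f y\<bar> \<le> \<epsilon>}" if I: "countable I" "I \<subseteq> M \<times> M" for I \<epsilon>
    proof -
      define J where "J = I \<union> prod.swap ` I"
      have J: "countable J" "J \<subseteq> M \<times> M" using I by (auto simp: J_def)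
      have "cdelta_in T (topspace T \<inter> (\<Inter>p\<in>J \<times> \<rat>. CX - G (fst (fst p)) (snd (fst p)) (snd p) \<epsilon>))"
      proof (rule cdelta_in_INT)
        show "countable (J \<times> (\<rat> :: real set))" using J by (simp add: countable_rat)
        show "constructible_in T (CX - G (fst (fst p)) (snd (fst p)) (snd p) \<epsilon>)" if "p \<in> J \<times> \<rat>" for p
          using that J(2) by (intro G) auto
      qed
      moreover have "topspace T \<inter> (\<Inter>p\<in>J \<times> \<rat>. CX - G (fst (fst p)) (snd (fst p)) (snd p) \<epsilon>)
        = {f \<in> CX. \<forall>(x, y)\<in>I. \<bar>f x - f y\<bar> \<le> \<epsilon>}"
      proof (intro set_eqI)
        fix f
        have "(\<forall>p\<in>J \<times> \<rat>. f \<notin> G (fst (fst p)) (snd (fst p)) (snd p) \<epsilon>) \<longleftrightarrow>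
          (\<forall>(x, y)\<in>I. \<not> (\<exists>s\<in>\<rat>. f \<in> G x y s \<epsilon> \<or> f \<in> G y x s \<epsilon>))"
          (is "?L \<longleftrightarrow> ?R")
        proof
          assume L: ?L
          have "f \<notin> G x y s \<epsilon> \<and> f \<notin> G y x s \<epsilon>" if "(x, y) \<in> I" "s \<in> \<rat>" for x y s
          proof -
            have "((x, y), s) \<in> J \<times> \<rat>" "((y, x), s) \<in> J \<times> \<rat>" using that by (force simp: J_def)+
            from L[THEN bspec, OF this(1)] L[THEN bspec, OF this(2)] show ?thesis by simp
          qed
          then show ?R by blast
        next
          assume ?R
          then show ?L unfolding J_def by auto
        qed
        moreover have "f \<in> topspace T \<inter> (\<Inter>p\<in>J \<times> \<rat>. CX - G (fst (fst p)) (snd (fst p)) (snd p) \<epsilon>) \<longleftrightarrow>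
          f \<in> CX \<and> (\<forall>p\<in>J \<times> \<rat>. f \<notin> G (fst (fst p)) (snd (fst p)) (snd p) \<epsilon>)"
          by (simp only: T Int_iff INT_iff Diff_iff) blast
        ultimately show "f \<in> topspace T \<inter> (\<Inter>p\<in>J \<times> \<rat>. CX - G (fst (fst p)) (snd (fst p)) (snd p) \<epsilon>)
          \<longleftrightarrow> f \<in> {f \<in> CX. \<forall>(x, y)\<in>I. \<bar>f x - f y\<bar> \<le> \<epsilon>}"
          by (cases "f \<in> CX") (simp_all only: near_iff mem_Collect_eq simp_thms)
      qed
      ultimately show ?thesis by (simp only: cdelta_imp_cdelta_sigma)
    qed
  qed
qed

section \<open>The three function spaces\<close>

lemma topspace_C_p [simp]: "topspace (C_p X) = C_fun X"
  unfolding C_p_def C_fun_def by (auto simp: PiE_def)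

lemma topspace_C_k [simp]: "topspace (C_k X) = C_fun X"
  unfolding C_k_def by auto

lemma topspace_C_Fell [simp]: "topspace (C_Fell X) = C_fun X"
  unfolding C_Fell_def by auto

lemma C_p_eval: "x \<in> topspace X \<Longrightarrow> continuous_map (C_p X) euclideanreal (\<lambda>f. f x)"
  unfolding C_p_def by (intro continuous_map_from_subtopology continuous_map_product_projection)

lemma C_k_eval:
  assumes "x \<in> topspace X"
  shows "continuous_map (C_k X) euclideanreal (\<lambda>f. f x)"
  unfolding continuous_map_upper_lower_semicontinuous_lt
proof (intro conjI allI)
  fix r
  have "openin (C_k X) {f \<in> C_fun X. r < Inf (f ` {x})}" "openin (C_k X) {f \<in> C_fun X. Sup (f ` {x}) < r}"
    unfolding C_k_def using assms by (intro topology_generated_by_Basis, blast intro: finite_imp_compactin)+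
  then show "openin (C_k X) {f \<in> topspace (C_k X). r < f x}" "openin (C_k X) {f \<in> topspace (C_k X). f x < r}"
    by simp_all
qed

lemma C_Fell_open_less:
  assumes "x \<in> topspace X"
  shows "openin (C_Fell X) {f \<in> C_fun X. f x < r}"
proof -
  have "openin (C_Fell X) {f \<in> C_fun X. Sup (f ` {x}) < r}"
    unfolding C_Fell_def using assms by (intro topology_generated_by_Basis) (blast intro: finite_imp_compactin)
  then show ?thesis by simp
qed

lemma open_less_if_eval:
  assumes "topspace T = C_fun X" "continuous_map T euclideanreal (\<lambda>f. f x)"
  shows "openin T {f \<in> C_fun X. f x < r}"
  using assms(2) unfolding continuous_map_upper_lower_semicontinuous_lt assms(1) by blast

text \<open>The compact-open topology on \<open>C(X)\<close> is the topology of uniform convergence on compact sets; this neighbourhood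
form of "finer than the compact-open topology" is the one that \<open>code_topology_compact_open\<close> provides.\<close>

definition refines_compact_open :: "('a \<Rightarrow> real) topology \<Rightarrow> 'a topology \<Rightarrow> bool" where
  "refines_compact_open P X \<longleftrightarrow> topspace P = C_fun X \<and>
    (\<forall>f L \<epsilon>. f \<in> C_fun X \<longrightarrow> compactin X L \<longrightarrow> \<epsilon> > 0 \<longrightarrow>
      (\<exists>W. openin P W \<and> f \<in> W \<and> (\<forall>g\<in>W. \<forall>x\<in>L. \<bar>g x - f x\<bar> < \<epsilon>)))"

lemma refines_compact_open_openI:
  assumes P: "refines_compact_open P X" and S: "S \<subseteq> C_fun X"
    and near: "\<And>f. f \<in> S \<Longrightarrow> \<exists>L \<epsilon>. compactin X L \<and> \<epsilon> > 0 \<and>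
      (\<forall>g\<in>C_fun X. (\<forall>x\<in>L. \<bar>g x - f x\<bar> < \<epsilon>) \<longrightarrow> g \<in> S)"
  shows "openin P S"
proof (subst openin_subopen, intro ballI)
  fix f assume f: "f \<in> S"
  obtain L \<epsilon> where L: "compactin X L" "\<epsilon> > 0" "\<forall>g\<in>C_fun X. (\<forall>x\<in>L. \<bar>g x - f x\<bar> < \<epsilon>) \<longrightarrow> g \<in> S"
    using near[OF f] by blast
  then obtain W where W: "openin P W" "f \<in> W" "\<forall>g\<in>W. \<forall>x\<in>L. \<bar>g x - f x\<bar> < \<epsilon>"
    using P f S unfolding refines_compact_open_def by blast
  have "W \<subseteq> C_fun X" using openin_subset[OF W(1)] P by (simp add: refines_compact_open_def)
  then have "W \<subseteq> S" using W(3) L(3) by blast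
  then show "\<exists>T. openin P T \<and> f \<in> T \<and> T \<subseteq> S" using W by blast
qed

lemma bdd_C_fun_image:
  assumes "f \<in> C_fun X" "compactin X L"
  shows "bdd_below (f ` L)" "bdd_above (f ` L)"
proof -
  have "compact (f ` L)"
    using image_compactin[OF assms(2), of euclideanreal f] assms(1) by (simp add: C_fun_def)
  then have "bounded (f ` L)" by (rule compact_imp_bounded)
  then show "bdd_below (f ` L)" "bdd_above (f ` L)"
    by (simp_all add: bounded_imp_bdd_below bounded_imp_bdd_above)
qed

lemma refines_open_Inf:
  assumes P: "refines_compact_open P X" and L: "compactin X L" "L \<noteq> {}"
  shows "openin P {f \<in> C_fun X. r < Inf (f ` L)}"
proof (rule refines_compact_open_openI[OF P])
  fix f assume "f \<in> {f \<in> C_fun X. r < Inf (f ` L)}"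
  then have f: "f \<in> C_fun X" "r < Inf (f ` L)" by auto
  define \<epsilon> where "\<epsilon> = (Inf (f ` L) - r) / 2"
  have "2 * ((s - r) / 2) = s - r" for s :: real by simp
  from this[of "Inf (f ` L)"] have Inf_eq: "Inf (f ` L) = r + 2 * \<epsilon>" unfolding \<epsilon>_def[symmetric] by simp
  have pos: "\<epsilon> > 0" using Inf_eq f(2) by linarith
  have "r < Inf (g ` L)" if "\<forall>x\<in>L. \<bar>g x - f x\<bar> < \<epsilon>" for g
  proof -
    have "r + \<epsilon> \<le> g x" if "x \<in> L" for x
    proof -
      have "Inf (f ` L) \<le> f x" using that bdd_C_fun_image(1)[OF f(1) L(1)] by (intro cInf_lower) auto
      moreover have "\<bar>g x - f x\<bar> < \<epsilon>" using that \<open>\<forall>x\<in>L. _\<close> by blast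
      ultimately show ?thesis using Inf_eq by linarith
    qed
    then have "r + \<epsilon> \<le> Inf (g ` L)" using L(2) by (intro cInf_greatest) auto
    then show ?thesis using pos by linarith
  qed
  then show "\<exists>L' \<epsilon>. compactin X L' \<and> \<epsilon> > 0 \<and> (\<forall>g\<in>C_fun X. (\<forall>x\<in>L'. \<bar>g x - f x\<bar> < \<epsilon>) \<longrightarrow> g \<in> {f \<in> C_fun X. r < Inf (f ` L)})"
    using L(1) f(2) by (intro exI[of _ L] exI[of _ \<epsilon>]) (auto simp: pos)
qed auto

lemma refines_open_Sup:
  assumes P: "refines_compact_open P X" and L: "compactin X L" "L \<noteq> {}"
  shows "openin P {f \<in> C_fun X. Sup (f ` L) < r}"
proof (rule refines_compact_open_openI[OF P])
  fix f assume "f \<in> {f \<in> C_fun X. Sup (f ` L) < r}"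
  then have f: "f \<in> C_fun X" "Sup (f ` L) < r" by auto
  define \<epsilon> where "\<epsilon> = (r - Sup (f ` L)) / 2"
  have "2 * ((r - s) / 2) = r - s" for s :: real by simp
  from this[of "Sup (f ` L)"] have Sup_eq: "Sup (f ` L) = r - 2 * \<epsilon>" unfolding \<epsilon>_def[symmetric] by simp
  have pos: "\<epsilon> > 0" using Sup_eq f(2) by linarith
  have "Sup (g ` L) < r" if near: "\<forall>x\<in>L. \<bar>g x - f x\<bar> < \<epsilon>" for g
  proof -
    have "g x \<le> r - \<epsilon>" if "x \<in> L" for x
    proof -
      have "f x \<le> Sup (f ` L)" using that bdd_C_fun_image(2)[OF f(1) L(1)] by (intro cSup_upper) auto
      moreover have "\<bar>g x - f x\<bar> < \<epsilon>" using that near by blast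
      ultimately show ?thesis using Sup_eq by linarith
    qed
    then have "Sup (g ` L) \<le> r - \<epsilon>" using L(2) by (intro cSup_least) auto
    then show ?thesis using pos by linarith
  qed
  then show "\<exists>L' \<epsilon>. compactin X L' \<and> \<epsilon> > 0 \<and> (\<forall>g\<in>C_fun X. (\<forall>x\<in>L'. \<bar>g x - f x\<bar> < \<epsilon>) \<longrightarrow> g \<in> {f \<in> C_fun X. Sup (f ` L) < r})"
    using L(1) f(2) by (intro exI[of _ L] exI[of _ \<epsilon>]) (auto simp: pos)
qed auto

lemma refines_eval:
  assumes P: "refines_compact_open P X" and x: "x \<in> topspace X"
  shows "continuous_map P euclideanreal (\<lambda>f. f x)"
proof -
  have top: "topspace P = C_fun X" using P by (simp add: refines_compact_open_def)
  have "compactin X {x}" using x by (simp add: finite_imp_compactin)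
  from refines_open_Inf[OF P this] refines_open_Sup[OF P this]
  show ?thesis unfolding continuous_map_upper_lower_semicontinuous_lt top by simp
qed

lemma continuous_map_refines_C_p:
  assumes P: "refines_compact_open P X"
  shows "continuous_map P (C_p X) id"
proof -
  have top: "topspace P = C_fun X" using P by (simp add: refines_compact_open_def)
  have "continuous_map P (powertop_real (topspace X)) id"
    unfolding continuous_map_componentwise using refines_eval[OF P] by (auto simp: top C_fun_def)
  then show ?thesis unfolding C_p_def continuous_map_in_subtopology using top by auto
qed

lemma continuous_map_refines_C_k:
  assumes P: "refines_compact_open P X"
  shows "continuous_map P (C_k X) id"
  unfolding C_k_def
proof (rule continuous_on_generated_topo)
  have top: "topspace P = C_fun X" using P by (simp add: refines_compact_open_def)
  fix U assume "U \<in> insert (C_fun X) ({{f \<in> C_fun X. Inf (f ` K) > r} | K r. compactin X K \<and> K \<noteq> {}} \<union>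
      {{f \<in> C_fun X. Sup (f ` K) < r} | K r. compactin X K \<and> K \<noteq> {}})"
  then have "openin P U"
    using refines_open_Inf[OF P] refines_open_Sup[OF P] openin_topspace[of P] top by auto
  then show "openin P (id -` U \<inter> topspace P)" by (simp add: openin_Int)
qed (use P in \<open>auto simp: refines_compact_open_def\<close>)

lemma continuous_map_refines_C_Fell:
  assumes P: "refines_compact_open P X"
  shows "continuous_map P (C_Fell X) id"
  unfolding C_Fell_def
proof (rule continuous_on_generated_topo)
  have top: "topspace P = C_fun X" using P by (simp add: refines_compact_open_def)
  have hyp: "openin P {f \<in> C_fun X. (SUP x\<in>U. ereal (f x)) > ereal r}" if U: "openin X U" for U r
  proof -
    have "{f \<in> C_fun X. (SUP x\<in>U. ereal (f x)) > ereal r} = (\<Union>x\<in>U. {f \<in> topspace P. r < f x})"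
      unfolding top by (auto simp: less_SUP_iff)
    moreover have "openin P {f \<in> topspace P. r < f x}" if "x \<in> U" for x
      using refines_eval[OF P, of x] openin_subset[OF U] that
      unfolding continuous_map_upper_lower_semicontinuous_lt by blast
    ultimately show ?thesis by auto
  qed
  fix U assume "U \<in> insert (C_fun X)
     ({{f \<in> C_fun X. Sup (f ` K) < r} | K r. compactin X K \<and> K \<noteq> {}} \<union>
      {{f \<in> C_fun X. (SUP x\<in>U. ereal (f x)) > ereal r} | U r. openin X U \<and> U \<noteq> {}})"
  then have "openin P U"
    using hyp refines_open_Sup[OF P] openin_topspace[of P] top by auto
  then show "openin P (id -` U \<inter> topspace P)" by (simp add: openin_Int)
qed (use P in \<open>auto simp: refines_compact_open_def\<close>)

text \<open>The Polish space is the set \<open>C(X)\<close> itself with a finer topology, and the continuous bijection is the identity.\<close>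

lemma class_Lusin_if_finer_Polish:
  assumes P: "Polish_space P" and top: "topspace P = topspace T" and id: "continuous_map P T id"
    and \<Gamma>: "\<And>U. openin P U \<Longrightarrow> \<Gamma> T U"
  shows "class_Lusin_space \<Gamma> T"
proof (rule class_Lusin_spaceI[OF P id])
  show "bij_betw id (topspace P) (topspace T)" using top by simp
  have inv: "inv_into (topspace P) id f = f" if "f \<in> topspace P" for f
    using inv_into_f_f[of id "topspace P" f] that by simp
  show "class_measurable \<Gamma> T P (inv_into (topspace P) id)"
    unfolding class_measurable_def
  proof (intro conjI allI impI)
    show "inv_into (topspace P) id \<in> topspace T \<rightarrow> topspace P" using inv top by auto
    fix U assume U: "openin P U"
    then have "{f \<in> topspace T. inv_into (topspace P) id f \<in> U} = U"
      using inv top openin_subset[OF U] by auto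
    then show "\<Gamma> T {f \<in> topspace T. inv_into (topspace P) id f \<in> U}" using \<Gamma>[OF U] by simp
  qed
qed

lemma class_Lusin_imp_Lusin: "class_Lusin_space \<Gamma> T \<Longrightarrow> Lusin_space T"
  unfolding class_Lusin_space_def Lusin_space_def by blast

lemma Lusin_imp_Suslin: "Lusin_space T \<Longrightarrow> Suslin_space T"
  unfolding Lusin_space_def Suslin_space_def bij_betw_def by blast

text \<open>If \<open>X\<close> is empty there is no dense sequence, but then \<open>C(X)\<close> is a single point.\<close>

lemma sigma_compact_imp_finer_Polish:
  fixes X :: "'a topology"
  assumes X: "metrizable_space X" "sigma_compact_space X"
  shows "\<exists>P. Polish_space P \<and> refines_compact_open P X \<and>
    (\<forall>T U. openin P U \<longrightarrow> topspace T = C_fun X \<longrightarrow>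
      (\<forall>x\<in>topspace X. continuous_map T euclideanreal (\<lambda>f. f x)) \<longrightarrow> fsigma_in T U) \<and>
    (\<forall>T U. openin P U \<longrightarrow> topspace T = C_fun X \<longrightarrow>
      (\<forall>x\<in>topspace X. \<forall>r. openin T {f \<in> C_fun X. f x < r}) \<longrightarrow> cdelta_sigma_in T U)"
proof (cases "topspace X = {}")
  case True
  define f0 :: "'a \<Rightarrow> real" where "f0 = (\<lambda>x. undefined)"
  have C: "C_fun X = {f0}" using True by (auto simp: C_fun_def f0_def continuous_map_def extensional_def)
  define P where "P = discrete_topology {f0}"
  have small: "U = {} \<or> U = C_fun X" if "openin P U" for U
    using that unfolding C P_def by auto
  show ?thesis
  proof (intro exI[of _ P] conjI allI impI)
    show "Polish_space P" unfolding Polish_space_def P_def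
      by (simp add: completely_metrizable_space_discrete_topology separable_space_discrete_topology)
    show "refines_compact_open P X"
      unfolding refines_compact_open_def P_def C by (auto intro!: exI[of _ "{f0}"])
    fix T U assume "openin P U" "topspace T = C_fun X"
    then have "openin T U" "closedin T U" using small[of U] openin_topspace[of T] closedin_topspace[of T] by auto
    then show "fsigma_in T U" "cdelta_sigma_in T U"
      by (simp_all add: closed_imp_fsigma_in constructible_imp_cdelta_sigma constructible_in_open)
  qed
next
  case False
  obtain M d K q where ce: "compact_exhaustion M d K q" and Xeq: "X = Metric_space.mtopology M d"
    using sigma_compact_metrizable_imp_exhaustion[OF X False] by blast
  interpret compact_exhaustion M d K q by (rule ce)
  show ?thesis unfolding Xeq
  proof (intro exI[of _ code_topology] conjI allI impI)
    show "Polish_space code_topology" by (rule Polish_code_topology)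
    show "refines_compact_open code_topology mtopology"
      unfolding refines_compact_open_def using code_topology_compact_open by simp
  qed (simp_all add: code_topology_open_fsigma code_topology_open_cdelta_sigma)
qed

theorem corollary1p8:
  fixes X :: "'a topology"
  assumes "metrizable_space X"
  shows "(sigma_compact_space X \<longleftrightarrow> class_Lusin_space fsigma_in (C_p X)) \<and>
    (sigma_compact_space X \<longleftrightarrow> class_Lusin_space fsigma_in (C_k X)) \<and>
    (sigma_compact_space X \<longleftrightarrow> class_Lusin_space cdelta_sigma_in (C_Fell X)) \<and>
    (sigma_compact_space X \<longleftrightarrow> Lusin_space (C_p X)) \<and>
    (sigma_compact_space X \<longleftrightarrow> Lusin_space (C_k X)) \<and>
    (sigma_compact_space X \<longleftrightarrow> Lusin_space (C_Fell X)) \<and>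
    (sigma_compact_space X \<longleftrightarrow> Suslin_space (C_p X)) \<and>
    (sigma_compact_space X \<longleftrightarrow> Suslin_space (C_k X)) \<and>
    (sigma_compact_space X \<longleftrightarrow> Suslin_space (C_Fell X))"
proof -
  have forward: "class_Lusin_space fsigma_in (C_p X) \<and> class_Lusin_space fsigma_in (C_k X) \<and>
      class_Lusin_space cdelta_sigma_in (C_Fell X)" if sc: "sigma_compact_space X"
  proof -
    obtain P where P: "Polish_space P" "refines_compact_open P X"
      "\<forall>T U. openin P U \<longrightarrow> topspace T = C_fun X \<longrightarrow>
        (\<forall>x\<in>topspace X. continuous_map T euclideanreal (\<lambda>f. f x)) \<longrightarrow> fsigma_in T U"
      "\<forall>T U. openin P U \<longrightarrow> topspace T = C_fun X \<longrightarrow>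
        (\<forall>x\<in>topspace X. \<forall>r. openin T {f \<in> C_fun X. f x < r}) \<longrightarrow> cdelta_sigma_in T U"
      using sigma_compact_imp_finer_Polish[OF assms sc] by blast
    have top: "topspace P = C_fun X" using P(2) by (simp add: refines_compact_open_def)
    have "class_Lusin_space fsigma_in (C_p X)"
    proof (rule class_Lusin_if_finer_Polish[OF P(1) _ continuous_map_refines_C_p[OF P(2)]])
      show "fsigma_in (C_p X) U" if "openin P U" for U
        by (rule P(3)[rule_format, OF that topspace_C_p C_p_eval])
    qed (simp add: top)
    moreover have "class_Lusin_space fsigma_in (C_k X)"
    proof (rule class_Lusin_if_finer_Polish[OF P(1) _ continuous_map_refines_C_k[OF P(2)]])
      show "fsigma_in (C_k X) U" if "openin P U" for U
        by (rule P(3)[rule_format, OF that topspace_C_k C_k_eval])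
    qed (simp add: top)
    moreover have "class_Lusin_space cdelta_sigma_in (C_Fell X)"
    proof (rule class_Lusin_if_finer_Polish[OF P(1) _ continuous_map_refines_C_Fell[OF P(2)]])
      show "cdelta_sigma_in (C_Fell X) U" if "openin P U" for U
        by (rule P(4)[rule_format, OF that topspace_C_Fell C_Fell_open_less])
    qed (simp add: top)
    ultimately show ?thesis by blast
  qed
  have backward: "sigma_compact_space X"
    if "Suslin_space (C_p X) \<or> Suslin_space (C_k X) \<or> Suslin_space (C_Fell X)"
    using that
  proof (elim disjE)
    assume "Suslin_space (C_p X)"
    then show ?thesis
      by (rule sigma_compact_if_Suslin_function_space[OF assms]) (simp_all add: open_less_if_eval C_p_eval)
  next
    assume "Suslin_space (C_k X)"
    then show ?thesis
      by (rule sigma_compact_if_Suslin_function_space[OF assms]) (simp_all add: open_less_if_eval C_k_eval)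
  next
    assume "Suslin_space (C_Fell X)"
    then show ?thesis
      by (rule sigma_compact_if_Suslin_function_space[OF assms]) (simp_all add: C_Fell_open_less)
  qed
  show ?thesis using forward backward class_Lusin_imp_Lusin Lusin_imp_Suslin by blast
qed

end
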